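(* Let $0<\alpha<1$ and let $A\in\mathbb{R}^{d\times d}$. Assume that the spectrum $\sigma(A)$ of $A$ satisfies $$\sigma(A)\subset\left\{\lambda\in\mathbb{C}\setminus\{0\}:|\arg(\lambda)|>\frac{\alpha\pi}{2}\right\}.$$ Then the following statements hold: (i) $\lim_{t\to\infty}\|E_\alpha(t^\alpha A)\|=0$; (ii) $\int_0^\infty\tau^{\alpha-1}\|E_{\alpha,\alpha}(\tau^\alpha A)\|\,d\tau<\infty$.
   Context: For $\alpha>0$, $\beta\in\mathbb{C}$ and a square complex matrix $M$, the matrix Mittag-Leffler function is $E_{\alpha,\beta}(M)=\sum_{k=0}^\infty\frac{M^k}{\Gamma(\alpha k+\beta)}$ (with $1/\Gamma$ taken to be $0$ at the poles of $\Gamma$), and $E_\alpha:=E_{\alpha,1}$. The argument $\arg$ takes values in $(-\pi,\pi]$, $\sigma(A)$ is the set of complex eigenvalues of $A$, and $\|\cdot\|$ is a matrix norm (all matrix norms on $d\times d$ matrices are equivalent). *)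

theory Defs
  imports "HOL-Analysis.Analysis"
begin

(* On the type of matrices the library operations * and ^ act componentwise,
   so the power with respect to the matrix product ** is defined here. *)
primrec mat_power :: "'a::semiring_1^'n^'n \<Rightarrow> nat \<Rightarrow> 'a^'n^'n" where
  "mat_power M 0 = mat 1"
| "mat_power M (Suc k) = M ** mat_power M k"

(* rGamma is the reciprocal Gamma function, which vanishes at the poles of Gamma.
   The series is a series in the normed space of matrices. *)
definition mittag_leffler :: "real \<Rightarrow> complex \<Rightarrow> complex^'n^'n \<Rightarrow> complex^'n^'n" where
  "mittag_leffler \<alpha> \<beta> M =
     (\<Sum>k. map_matrix (\<lambda>z. rGamma (of_real (\<alpha> * real k) + \<beta>) * z) (mat_power M k))"

abbreviation cmat :: "real^'n^'m \<Rightarrow> complex^'n^'m" where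
  "cmat A \<equiv> map_matrix complex_of_real A"

definition mat_spectrum :: "complex^'n^'n \<Rightarrow> complex set" where
  "mat_spectrum M = {\<mu>. \<exists>v. v \<noteq> 0 \<and> M *v v = \<mu> *s v}"

(* Only real homogeneity is required. Hence every norm on the complex vector space of
   complex matrices is included, and every norm N on the real matrices is the restriction
   of one of these, e.g. of the sum of N at the real and N at the imaginary part.
   Submultiplicativity is not required. *)
definition is_matrix_norm :: "(complex^'n^'m \<Rightarrow> real) \<Rightarrow> bool" where
  "is_matrix_norm N \<longleftrightarrow>
     (\<forall>M. 0 \<le> N M) \<and>
     (\<forall>M. N M = 0 \<longleftrightarrow> M = 0) \<and>
     (\<forall>c M. N (c *\<^sub>R M) = \<bar>c\<bar> * N M) \<and>
     (\<forall>M M'. N (M + M') \<le> N M + N M')"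

end

theory Submission
  imports Defs "HOL-Complex_Analysis.Complex_Analysis" "HOL-Real_Asymp.Real_Asymp"
    "HOL-Computational_Algebra.Fundamental_Theorem_Algebra"
begin

text \<open>
  Let \<open>\<Omega>\<close> be the open sector \<open>|arg z| > \<alpha> \<pi> / 2\<close>, written as \<open>Re z < |z| cos (\<alpha> \<pi> / 2)\<close>.

  Matrices are reduced to scalars by Newton interpolation: some product of factors \<open>A - l\<close>, with all
  \<open>l\<close> eigenvalues, is zero. Dividing a polynomial \<open>p\<close> successively by the factors \<open>z - l\<close> and bounding
  the quotients by the maximum principle gives \<open>\<parallel>p(A)\<parallel> \<le> C sup\<^bsub>K\<^esub> |p|\<close> with a compact \<open>K\<close> inside \<open>\<Omega>\<close>
  that depends on \<open>A\<close> only. By approximation this also holds for entire functions.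

  For the scalar estimates, integrals over the wedge \<open>a - \<kappa> |r| + i r\<close> (\<open>r\<close> real) do not depend on the
  vertex \<open>a > 0\<close>. Letting \<open>a\<close> tend to 0 and using the reflection formula yields Hankel's integral for
  \<open>1 / \<Gamma>\<close>. Summing a geometric series under the integral for large \<open>a\<close> and then moving the vertex to 1
  represents \<open>E\<^bsub>\<alpha>,\<beta>\<^esub>(y)\<close> by the integral of \<open>exp s * s powr (\<alpha> - \<beta>) / (s powr \<alpha> - y)\<close> over \<open>2 \<pi> i\<close>.
  If \<open>\<kappa>\<close> is small enough, \<open>|s powr \<alpha> - t z| \<ge> \<delta> t\<close> for \<open>z\<close> in \<open>K\<close> and all \<open>s\<close> in the region swept by the
  wedges, whence \<open>E\<^bsub>\<alpha>,1\<^esub>(t z) = O(1/t)\<close> and \<open>E\<^bsub>\<alpha>,\<alpha>\<^esub>(t z) = O(1/t\<^sup>2)\<close> uniformly on \<open>K\<close>.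
\<close>

unbundle no fps_syntax

section \<open>Polynomials in a matrix\<close>

lemma mat_add: "mat (c + d) = mat c + (mat d :: 'a::semiring_1^'n^'n)"
  by (simp add: mat_def vec_eq_iff)

lemma mat_mult_nth: "(mat c ** M) $ i $ j = c * (M :: 'a::semiring_1^'m^'n) $ i $ j"
proof -
  have "(\<Sum>k\<in>UNIV. (if i = k then c else 0) * M $ k $ j) = (\<Sum>k\<in>UNIV. if i = k then c * M $ k $ j else 0)"
    by (intro sum.cong) auto
  then show ?thesis by (simp add: mat_def matrix_matrix_mult_def)
qed

text \<open>Rewrites the entrywise scaling in the definition of \<open>mittag_leffler\<close> as a
  product with a scalar matrix, so that only the algebra of \<open>**\<close> is needed
  afterwards.\<close>

lemma map_matrix_mult_eq_mat: "map_matrix (\<lambda>z. c * z) M = mat c ** (M :: 'a::semiring_1^'m^'n)"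
  by (simp add: vec_eq_iff mat_mult_nth map_matrix_def)

lemma mat_mult_mat: "mat c ** mat d = (mat (c * d) :: 'a::semiring_1^'n^'n)"
  by (simp add: vec_eq_iff mat_mult_nth) (simp add: mat_def)

lemma mat_mult_commute: "M ** mat c = mat c ** (M :: 'a::comm_semiring_1^'n^'n)"
proof -
  have "(\<Sum>k\<in>UNIV. M $ i $ k * (if k = j then c else 0)) = (\<Sum>k\<in>UNIV. if k = j then c * M $ i $ k else 0)" for i j
    by (intro sum.cong) (auto simp: mult.commute)
  then show ?thesis
    by (simp add: vec_eq_iff mat_mult_nth) (simp add: mat_def matrix_matrix_mult_def)
qed

lemma mat_mult_left_commute: "(M :: 'a::comm_semiring_1^'n^'n) ** (mat c ** X) = mat c ** (M ** X)"
  by (simp add: matrix_mul_assoc mat_mult_commute[of M])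

lemma mat_mult_eq_0: "mat c ** M = 0 \<Longrightarrow> c \<noteq> 0 \<Longrightarrow> M = (0 :: 'a::field^'m^'n)"
  by (simp add: vec_eq_iff mat_mult_nth)

lemma matrix_diff_rdistrib: "(A - B) ** C = A ** C - B ** (C :: 'a::ring_1^'m^'n)"
  by (simp add: matrix_matrix_mult_def vec_eq_iff left_diff_distrib sum_subtractf)

lemma matrix_diff_ldistrib: "A ** (B - C) = A ** B - A ** (C :: 'a::ring_1^'m^'n)"
  by (simp add: matrix_matrix_mult_def vec_eq_iff right_diff_distrib sum_subtractf)

text \<open>Horner's scheme with respect to \<open>**\<close>; the fold gives the recursion over
  \<open>pCons\<close> on which the inductions below rest.\<close>

definition mat_poly :: "'a::comm_ring_1^'n^'n \<Rightarrow> 'a poly \<Rightarrow> 'a^'n^'n" where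
  "mat_poly A p = fold_coeffs (\<lambda>c X. mat c + A ** X) p 0"

lemma mat_poly_0 [simp]: "mat_poly A 0 = 0"
  by (simp add: mat_poly_def)

lemma mat_poly_pCons [simp]: "mat_poly A (pCons c p) = mat c + A ** mat_poly A p"
  \<comment> \<open>The fold ignores a zero coefficient put in front of the zero polynomial; in that
    case both sides are the zero matrix.\<close>
  by (cases "c = 0 \<and> p = 0") (auto simp: mat_poly_def mat_0)

lemma mat_poly_add: "mat_poly A (p + q) = mat_poly A p + mat_poly A q"
  by (induction p q rule: poly_induct2) (simp_all add: mat_add matrix_add_ldistrib algebra_simps)

lemma mat_poly_smult: "mat_poly A (smult c p) = mat c ** mat_poly A p"
  by (induction p) (simp_all add: matrix_add_ldistrib mat_mult_mat mat_mult_left_commute)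

lemma mat_poly_sum: "mat_poly A (sum f I) = (\<Sum>i\<in>I. mat_poly A (f i))"
  by (induction I rule: infinite_finite_induct) (simp_all add: mat_poly_add)

lemma mat_poly_monom: "mat_poly A (monom c k) = mat c ** mat_power A k"
  by (induction k) (simp_all add: monom_0 monom_Suc mat_mult_left_commute mat_0)

text \<open>The identity \<open>p = p(l) + (z - l) q\<close>, with \<open>q\<close> the synthetic
  quotient, evaluated at \<open>A\<close>. It is one step of Newton interpolation.\<close>

lemma mat_poly_synthetic_div:
  "mat_poly A p = mat (poly p l) + (A - mat l) ** mat_poly A (synthetic_div p l)"
  using arg_cong[OF synthetic_div_correct[of p l], of "mat_poly A"]
  by (simp add: mat_poly_add mat_poly_smult matrix_diff_rdistrib algebra_simps)

text \<open>A list of nodes allows repetitions, as multiple roots of a minimal polynomial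
  require.\<close>

definition lin_prod :: "'a::comm_ring_1^'n^'n \<Rightarrow> 'a list \<Rightarrow> 'a^'n^'n" where
  "lin_prod A ls = foldr (\<lambda>l X. (A - mat l) ** X) ls (mat 1)"

lemma lin_prod_Nil [simp]: "lin_prod A [] = mat 1"
  and lin_prod_Cons [simp]: "lin_prod A (l # ls) = (A - mat l) ** lin_prod A ls"
  by (simp_all add: lin_prod_def)

lemma lin_prod_append: "lin_prod A (xs @ ys) = lin_prod A xs ** lin_prod A ys"
  by (induction xs) (simp_all add: matrix_mul_assoc)

lemma lin_prod_commute: "(A - mat l) ** lin_prod A ls = lin_prod A ls ** (A - mat l)"
proof (induction ls)
  case (Cons m ls)
  have "(A - mat l) ** (A - mat m) = (A - mat m) ** (A - mat l)"
    by (simp add: matrix_diff_rdistrib matrix_diff_ldistrib mat_mult_mat mat_mult_commute[of A] algebra_simps)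
  then show ?case
    by (metis Cons lin_prod_Cons matrix_mul_assoc)
qed simp

text \<open>By the fundamental theorem of algebra one root after another splits off; the nonzero
  constant left in degree 0 is \<open>c\<close>.\<close>

lemma mat_poly_factor:
  fixes A :: "complex^'n^'n"
  assumes "p \<noteq> 0"
  shows "\<exists>c ls. c \<noteq> 0 \<and> mat_poly A p = mat c ** lin_prod A ls"
  using assms
proof (induction "degree p" arbitrary: p)
  case 0
  then obtain c where "p = [:c:]" "c \<noteq> 0" by (metis degree_eq_zeroE pCons_0_0)
  then have "mat_poly A p = mat c ** lin_prod A []" by simp
  with \<open>c \<noteq> 0\<close> show ?case by blast
next
  case (Suc n)
  then obtain l where l: "poly p l = 0"
    using alg_closed_imp_poly_has_root[of p] by auto
  define q where "q = synthetic_div p l"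
  have "degree q = n" using Suc(2) by (simp add: q_def degree_synthetic_div)
  moreover have "q \<noteq> 0"
    using Suc(2) synthetic_div_eq_0_iff[of p l] by (simp add: q_def)
  ultimately obtain c ls where "c \<noteq> 0" "mat_poly A q = mat c ** lin_prod A ls"
    using Suc(1)[of q] by auto
  then have "mat_poly A p = mat c ** lin_prod A (l # ls)"
    using mat_poly_synthetic_div[of A p l] l by (simp add: q_def mat_0 mat_mult_left_commute)
  with \<open>c \<noteq> 0\<close> show ?case by blast
qed

section \<open>Annihilating products of linear factors\<close>

lemma mat_scaleR: "mat (of_real c) ** M = c *\<^sub>R (M :: complex^'m^'n)"
  by (simp add: vec_eq_iff mat_mult_nth) (simp add: scaleR_conv_of_real)

text \<open>The powers of \<open>A\<close> live in a space of finite real dimension. Dependence is a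
  property of the set of powers, so coinciding powers, which would collapse in that set, are treated
  first; their difference already gives a polynomial.\<close>

lemma annihilating_poly_exists:
  fixes A :: "complex^'n^'n"
  shows "\<exists>p. p \<noteq> 0 \<and> mat_poly A p = 0"
proof (cases "inj (mat_power A)")
  case False
  then obtain i j where ij: "i \<noteq> j" "mat_power A i = mat_power A j" by (auto simp: inj_def)
  let ?p = "monom 1 i + monom (-1) j :: complex poly"
  have "coeff ?p i = 1" using ij by simp
  then have "?p \<noteq> 0" by (metis coeff_0 zero_neq_one)
  moreover have "mat_poly A ?p = 0"
    using ij(2) by (simp add: mat_poly_add mat_poly_monom vec_eq_iff mat_mult_nth)
  ultimately show ?thesis by blast
next
  case True
  \<comment> \<open>\<open>I\<close> has one index more than the real dimension, which forces
    dependence.\<close>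
  define I where "I = {..DIM(complex^'n^'n)}"
  have inj: "inj_on (mat_power A) I" using True by (rule inj_on_subset) simp
  have "dependent (mat_power A ` I)"
    by (rule dependent_biggerset) (simp add: card_image[OF inj], simp add: I_def)
  then obtain u v where u: "(\<Sum>v\<in>mat_power A ` I. u v *\<^sub>R v) = 0" and v: "v \<in> mat_power A ` I" "u v \<noteq> 0"
    using dependent_finite[of "mat_power A ` I"] by (auto simp: I_def)
  then obtain k where k: "k \<in> I" "u (mat_power A k) \<noteq> 0" by auto
  let ?p = "\<Sum>i\<in>I. monom (of_real (u (mat_power A i))) i :: complex poly"
  have "coeff ?p k = of_real (u (mat_power A k))"
    using k by (simp add: coeff_sum I_def)
  then have "?p \<noteq> 0" using k by (metis coeff_0 of_real_eq_0_iff)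
  moreover have "mat_poly A ?p = 0"
    using u by (simp add: mat_poly_sum mat_poly_monom mat_scaleR sum.reindex[OF inj])
  ultimately show ?thesis by blast
qed

lemma matrix_eq_0_if_columns: "(\<And>v. M *v v = 0) \<Longrightarrow> M = (0 :: 'a::semiring_1^'m^'n)"
  by (metis matrix_eq matrix_vector_mult_0)

lemma mat_vector_mult: "mat c *v v = c *s (v :: 'a::semiring_1^'n)"
proof -
  have "(\<Sum>j\<in>UNIV. (if i = j then c else 0) * v $ j) = (\<Sum>j\<in>UNIV. if i = j then c * v $ j else 0)" for i
    by (intro sum.cong) auto
  then show ?thesis by (simp add: vec_eq_iff matrix_vector_mult_def mat_def)
qed

lemma annihilating_spectral_list:
  fixes A :: "complex^'n^'n"
  obtains ls where "lin_prod A ls = 0" "set ls \<subseteq> mat_spectrum A"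
proof -
  obtain p where p: "p \<noteq> 0" "mat_poly A p = 0" using annihilating_poly_exists by blast
  then obtain c ms where ms: "c \<noteq> 0" "mat_poly A p = mat c ** lin_prod A ms"
    using mat_poly_factor by blast
  then have "\<exists>ls. lin_prod A ls = 0" using p mat_mult_eq_0 by metis
  then obtain ls where ls: "lin_prod A ls = 0"
    and least: "\<And>ks. lin_prod A ks = 0 \<Longrightarrow> length ls \<le> length ks"
    using ex_has_least_nat[of "\<lambda>ls. lin_prod A ls = 0" _ length] by blast
  have "l \<in> mat_spectrum A" if "l \<in> set ls" for l
  proof -
    obtain xs ys where xy: "ls = xs @ l # ys" using split_list[OF \<open>l \<in> set ls\<close>] by blast
    define Q where "Q = lin_prod A (xs @ ys)"
    have "Q \<noteq> 0" using least[of "xs @ ys"] xy by (auto simp: Q_def)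
    then obtain v where v: "Q *v v \<noteq> 0" using matrix_eq_0_if_columns by blast
    have "(A - mat l) ** Q = lin_prod A ls"
      unfolding Q_def xy by (metis lin_prod_append lin_prod_Cons matrix_mul_assoc lin_prod_commute)
    then have "(A - mat l) *v (Q *v v) = 0"
      by (simp add: ls matrix_vector_mul_assoc)
    then have "A *v (Q *v v) = l *s (Q *v v)"
      by (simp add: matrix_vector_mult_diff_rdistrib mat_vector_mult)
    with v show ?thesis by (auto simp: mat_spectrum_def)
  qed
  with ls that show ?thesis by blast
qed

text \<open>The quotient is \<open>(p(z) - p(l)) / (z - l)\<close>, at most \<open>2 * M / r\<close>
  at distance \<open>r\<close> or more from \<open>l\<close>. Closer to \<open>l\<close> the maximum
  principle carries the bound over from the sphere of radius \<open>r\<close>, which belongs to the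
  same union of balls. The set does not shrink, so the estimate can be iterated.\<close>

lemma norm_synthetic_div_le:
  fixes p :: "complex poly"
  assumes "r > 0" and l: "l \<in> S" and M: "\<And>z. z \<in> (\<Union>m\<in>S. cball m r) \<Longrightarrow> norm (poly p z) \<le> M"
    and z: "z \<in> (\<Union>m\<in>S. cball m r)"
  shows "norm (poly (synthetic_div p l) z) \<le> 2 * M / r"
proof -
  define q where "q = synthetic_div p l"
  have eq: "poly p z - poly p l = (z - l) * poly q z" for z
    using arg_cong[OF synthetic_div_correct'[of l p], of "\<lambda>p. poly p z"]
    by (simp add: q_def algebra_simps)
  have lK: "l \<in> (\<Union>m\<in>S. cball m r)" using l \<open>r > 0\<close> by force
  have far: "norm (poly q z) \<le> 2 * M / r" if z: "z \<in> (\<Union>m\<in>S. cball m r)" "r \<le> norm (z - l)" for z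
  proof -
    have "r * norm (poly q z) \<le> norm (z - l) * norm (poly q z)" using z by (intro mult_right_mono) auto
    also have "\<dots> = norm (poly p z - poly p l)" by (simp add: eq norm_mult)
    also have "\<dots> \<le> M + M" using M[OF z(1)] M[OF lK] norm_triangle_ineq4[of "poly p z" "poly p l"] by linarith
    finally show ?thesis using \<open>r > 0\<close> by (simp add: field_simps)
  qed
  have "norm (poly q z) \<le> 2 * M / r"
  proof (cases "r \<le> norm (z - l)")
    case False
    show ?thesis
    proof (rule maximum_modulus_frontier[of "poly q" "cball l r"])
      show "z \<in> cball l r" using False by (simp add: dist_norm norm_minus_commute)
      fix w assume "w \<in> frontier (cball l r)"
      then have "w \<in> sphere l r" by (simp add: frontier_cball)
      then show "norm (poly q w) \<le> 2 * M / r"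
        using l by (intro far) (auto simp: dist_norm norm_minus_commute)
    qed (auto intro: holomorphic_intros continuous_intros)
  qed (use z far in blast)
  then show ?thesis by (simp add: q_def)
qed

lemma matrix_mult_left_bounded:
  fixes B :: "complex^'n^'n"
  obtains D where "D \<ge> 0" "\<And>X :: complex^'n^'n. norm (B ** X) \<le> D * norm X"
proof -
  have "bounded_linear (\<lambda>X::complex^'n^'n. B ** X)"
    by (intro linear_conv_bounded_linear[THEN iffD1] linearI)
      (simp_all add: matrix_add_ldistrib mat_scaleR[symmetric] mat_mult_left_commute)
  then obtain D where "\<And>X :: complex^'n^'n. norm (B ** X) \<le> norm X * D" "D \<ge> 0"
    using bounded_linear.nonneg_bounded by blast
  then show ?thesis using that by (metis mult.commute)
qed

lemma mat_norm_bounded: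
  obtains D where "D \<ge> 0" "\<And>c. norm (mat c :: complex^'n^'n) \<le> D * norm c"
proof -
  have "bounded_linear (mat :: complex \<Rightarrow> complex^'n^'n)"
    by (intro linear_conv_bounded_linear[THEN iffD1] linearI)
      (simp_all add: mat_add, simp add: mat_def vec_eq_iff)
  then obtain D where "\<And>c. norm (mat c :: complex^'n^'n) \<le> norm c * D" "D \<ge> 0"
    using bounded_linear.nonneg_bounded by blast
  then show ?thesis using that by (metis mult.commute)
qed

text \<open>Newton interpolation with remainder: each division contributes a value of a quotient,
  bounded by the preceding estimate, and \<open>X\<close> is the last quotient evaluated at
  \<open>A\<close>. The constant is chosen before \<open>p\<close>. Once the product of the factors
  is zero, the remainder disappears.\<close>

lemma mat_poly_newton_bound:
  fixes A :: "complex^'n^'n"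
  assumes r: "r > 0" and "set ls \<subseteq> S"
  shows "\<exists>C\<ge>0. \<forall>p M. M \<ge> 0 \<longrightarrow> (\<forall>z\<in>(\<Union>m\<in>S. cball m r). norm (poly p z) \<le> M) \<longrightarrow>
           (\<exists>X. norm (mat_poly A p - lin_prod A ls ** X) \<le> C * M)"
  using assms(2)
proof (induction ls)
  case Nil
  \<comment> \<open>The empty product is the identity, so \<open>X = mat_poly A p\<close> leaves the
    difference zero.\<close>
  show ?case by (rule exI[of _ 0]) (auto intro: exI[of _ "mat_poly A _"])
next
  case (Cons l ls)
  define K where "K = (\<Union>m\<in>S. cball m r)"
  from Cons obtain C where "C \<ge> 0" and C: "\<And>p M. M \<ge> 0 \<Longrightarrow> \<forall>z\<in>K. norm (poly p z) \<le> M \<Longrightarrow>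
           \<exists>X. norm (mat_poly A p - lin_prod A ls ** X) \<le> C * M" by (auto simp: K_def)
  obtain D1 where D1: "D1 \<ge> 0" "\<And>c. norm (mat c :: complex^'n^'n) \<le> D1 * norm c"
    using mat_norm_bounded by blast
  obtain D2 where D2: "D2 \<ge> 0" "\<And>X :: complex^'n^'n. norm ((A - mat l) ** X) \<le> D2 * norm X"
    using matrix_mult_left_bounded by blast
  have "\<exists>X. norm (mat_poly A p - lin_prod A (l # ls) ** X) \<le> (D1 + D2 * (C * (2 / r))) * M"
    if M: "M \<ge> 0" "\<forall>z\<in>K. norm (poly p z) \<le> M" for p M
  proof -
    let ?q = "synthetic_div p l"
    have "\<forall>z\<in>K. norm (poly ?q z) \<le> 2 * M / r"
      using norm_synthetic_div_le[OF r, of l S p M] Cons(2) M by (auto simp: K_def)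
    then obtain X where X: "norm (mat_poly A ?q - lin_prod A ls ** X) \<le> C * (2 * M / r)"
      using C[of "2 * M / r" ?q] M r by auto
    have lK: "norm (poly p l) \<le> M" using M Cons(2) r by (force simp: K_def)
    have "mat_poly A p - lin_prod A (l # ls) ** X
        = mat (poly p l) + (A - mat l) ** (mat_poly A ?q - lin_prod A ls ** X)"
      by (subst mat_poly_synthetic_div[of A p l]) (simp add: matrix_diff_ldistrib matrix_mul_assoc)
    also have "norm \<dots> \<le> D1 * norm (poly p l) + D2 * norm (mat_poly A ?q - lin_prod A ls ** X)"
      by (intro norm_triangle_mono D1 D2)
    also have "\<dots> \<le> D1 * M + D2 * (C * (2 * M / r))"
      using X lK D1(1) D2(1) by (intro add_mono mult_left_mono)
    also have "\<dots> = (D1 + D2 * (C * (2 / r))) * M" by (simp add: algebra_simps)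
    finally show ?thesis by blast
  qed
  then show ?case
    using D1(1) D2(1) \<open>C \<ge> 0\<close> r unfolding K_def
    by (intro exI[of _ "D1 + D2 * (C * (2 / r))"] conjI) auto
qed

text \<open>Newton interpolation at nodes whose product annihilates \<open>A\<close>;
  \<open>K\<close> consists of small closed balls around these eigenvalues. This serves as the
  functional calculus of the proof: it turns scalar bounds on \<open>K\<close> into matrix
  bounds.\<close>

lemma spectral_bound:
  fixes A :: "complex^'n^'n"
  assumes "open W" and "mat_spectrum A \<subseteq> W"
  obtains K C where "compact K" "K \<subseteq> W" "C \<ge> 0"
    "\<And>p M. M \<ge> 0 \<Longrightarrow> (\<And>z. z \<in> K \<Longrightarrow> norm (poly p z) \<le> M) \<Longrightarrow> norm (mat_poly A p) \<le> C * M"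
proof -
  obtain ls where ls: "lin_prod A ls = 0" "set ls \<subseteq> mat_spectrum A"
    by (rule annihilating_spectral_list)
  have "\<exists>r>0. (\<Union>m\<in>set ls. cball m r) \<subseteq> W"
  proof -
    have "compact (set ls)" "set ls \<subseteq> W" using ls assms by (auto simp: finite_imp_compact)
    from compact_subset_open_imp_cball_epsilon_subset[OF this(1) assms(1) this(2)]
    show ?thesis by metis
  qed
  then obtain r where r: "r > 0" "(\<Union>m\<in>set ls. cball m r) \<subseteq> W" by blast
  from mat_poly_newton_bound[OF r(1) order.refl, where ls = ls and A = A]
  obtain C where C: "C \<ge> 0" "\<And>p M. M \<ge> 0 \<Longrightarrow> \<forall>z\<in>(\<Union>m\<in>set ls. cball m r). norm (poly p z) \<le> M \<Longrightarrow>
           norm (mat_poly A p) \<le> C * M"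
    by (auto simp: ls)
  show ?thesis
  proof (rule that[of "\<Union>m\<in>set ls. cball m r" C])
    show "compact (\<Union>m\<in>set ls. cball m r)" by (intro compact_UN) auto
    show "norm (mat_poly A p) \<le> C * M"
      if "M \<ge> 0" "\<And>z. z \<in> (\<Union>m\<in>set ls. cball m r) \<Longrightarrow> norm (poly p z) \<le> M" for p M
      using that by (intro C(2) ballI)
  qed (fact r(2), fact C(1))
qed

section \<open>Integrals over wedge contours\<close>

text \<open>For \<open>\<kappa> > 0\<close> this is an open sector around the positive axis with
  half-angle between \<open>pi / 2\<close> and \<open>pi\<close>. It is the region swept by the
  wedges with positive vertex, and it avoids the branch cut of \<open>Ln\<close>.\<close>

definition wedge_region :: "real \<Rightarrow> complex set" where
  "wedge_region \<kappa> = {s. 0 < Re s + \<kappa> * \<bar>Im s\<bar>}"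

text \<open>A Hankel-type contour parametrised by the imaginary part. For
  \<open>\<kappa> > 0\<close> both arms run to the left, where \<open>exp\<close> decays like
  \<open>exp (- \<kappa> * \<bar>r\<bar>)\<close>.\<close>

definition wedge :: "real \<Rightarrow> real \<Rightarrow> real \<Rightarrow> complex" where
  "wedge \<kappa> a r = Complex (a - \<kappa> * \<bar>r\<bar>) r"

text \<open>The derivative of \<open>wedge\<close> off the corner \<open>r = 0\<close>; the value
  \<open>\<i>\<close> taken there affects no integral.\<close>

definition wedge_deriv :: "real \<Rightarrow> real \<Rightarrow> complex" where
  "wedge_deriv \<kappa> r = Complex (- \<kappa> * sgn r) 1"

text \<open>The contour integral over the unbounded wedge, taken as a Lebesgue integral so that
  dominated convergence applies.\<close>

definition wedge_integral :: "real \<Rightarrow> (complex \<Rightarrow> complex) \<Rightarrow> real \<Rightarrow> complex" where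
  "wedge_integral \<kappa> f a = (LINT r|lborel. f (wedge \<kappa> a r) * wedge_deriv \<kappa> r)"

lemma wedge_sel [simp]: "Re (wedge \<kappa> a r) = a - \<kappa> * \<bar>r\<bar>" "Im (wedge \<kappa> a r) = r"
  by (simp_all add: wedge_def)

lemma wedge_in_region [simp]: "wedge \<kappa> a r \<in> wedge_region \<kappa> \<longleftrightarrow> a > 0"
  by (simp add: wedge_region_def)

lemma wedge_eq: "wedge \<kappa> a r = of_real (a - \<kappa> * \<bar>r\<bar>) + \<i> * of_real r"
  by (simp add: complex_eq_iff)

lemma continuous_wedge [continuous_intros]: "continuous_on S (wedge \<kappa> a)"
  unfolding wedge_eq[abs_def] by (intro continuous_intros)

lemma wedge_deriv_eq: "wedge_deriv \<kappa> r = of_real (- \<kappa> * sgn r) + \<i>"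
  by (simp add: complex_eq_iff wedge_deriv_def)

lemma norm_wedge_deriv_le: "\<kappa> \<ge> 0 \<Longrightarrow> norm (wedge_deriv \<kappa> r) \<le> 1 + \<kappa>"
  using cmod_le[of "wedge_deriv \<kappa> r"]
  by (auto simp: wedge_deriv_def sgn_if split: if_splits)

lemma wedge_has_vector_derivative:
  assumes "r \<noteq> 0"
  shows "(wedge \<kappa> a has_vector_derivative wedge_deriv \<kappa> r) (at r)"
proof -
  have "((\<lambda>r. \<bar>r\<bar>) has_real_derivative sgn r) (at r)"
  proof (cases "r > 0")
    case True
    then show ?thesis
      using has_field_derivative_transform_within_open[OF DERIV_ident, of "{0<..}" r abs] by simp
  next
    case False
    then show ?thesis using assms
        has_field_derivative_transform_within_open[OF DERIV_minus[OF DERIV_ident], of "{..<0}" r abs] by simp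
  qed
  then have "((\<lambda>r. of_real (a - \<kappa> * \<bar>r\<bar>) + \<i> * of_real r) has_vector_derivative
      (of_real (0 - \<kappa> * sgn r) + \<i> * of_real 1)) (at r)"
    by (intro has_vector_derivative_add has_vector_derivative_of_real has_vector_derivative_mult_right
        DERIV_diff DERIV_const DERIV_cmult DERIV_ident)
  then show ?thesis by (simp add: wedge_eq[abs_def] wedge_deriv_eq)
qed

lemma open_wedge_region: "open (wedge_region \<kappa>)"
  unfolding wedge_region_def by (intro open_Collect_less continuous_intros)

text \<open>The region is not convex, but every point is visible from 1, which is enough for global
  primitives of holomorphic functions.\<close>

lemma starlike_wedge_region:
  assumes "\<kappa> > 0"
  shows "starlike (wedge_region \<kappa>)"
  unfolding starlike_def
proof (intro bexI ballI subsetI)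
  show "1 \<in> wedge_region \<kappa>" by (simp add: wedge_region_def)
  fix x y assume x: "x \<in> wedge_region \<kappa>" and "y \<in> closed_segment 1 x"
  then obtain u where u: "0 \<le> u" "u \<le> 1" "y = (1 - u) *\<^sub>R 1 + u *\<^sub>R x"
    by (auto simp: closed_segment_def)
  have y: "Re y = 1 - u + u * Re x" "Im y = u * Im x" unfolding u(3) by simp_all
  have "Re y + \<kappa> * \<bar>Im y\<bar> = (1 - u) + u * (Re x + \<kappa> * \<bar>Im x\<bar>)"
    unfolding y using u(1) by (simp add: abs_mult algebra_simps)
  also have "\<dots> > 0"
    using u x by (cases "u = 1") (auto simp: wedge_region_def add_pos_nonneg)
  finally show "y \<in> wedge_region \<kappa>" by (simp add: wedge_region_def)
qed

text \<open>The first bound follows from \<open>a = Re s + \<kappa> * \<bar>Im s\<bar>\<close> for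
  \<open>s\<close> on the wedge and controls negative powers for a vertex away from 0. The second is
  uniform in the vertex and supplies a majorant as the vertex tends to 0.\<close>

lemma wedge_norm_ge:
  assumes "\<kappa> > 0"
  shows "a / (1 + \<kappa>) \<le> norm (wedge \<kappa> a r)" "\<bar>r\<bar> \<le> norm (wedge \<kappa> a r)"
proof -
  show r: "\<bar>r\<bar> \<le> norm (wedge \<kappa> a r)" using abs_Im_le_cmod[of "wedge \<kappa> a r"] by simp
  have "a - \<kappa> * \<bar>r\<bar> \<le> norm (wedge \<kappa> a r)" using complex_Re_le_cmod[of "wedge \<kappa> a r"] by simp
  moreover have "\<kappa> * \<bar>r\<bar> \<le> \<kappa> * norm (wedge \<kappa> a r)" using r assms by (intro mult_left_mono) auto
  ultimately have "a \<le> (1 + \<kappa>) * norm (wedge \<kappa> a r)" by (simp add: algebra_simps)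
  then show "a / (1 + \<kappa>) \<le> norm (wedge \<kappa> a r)" using assms by (simp add: field_simps)
qed

section \<open>Absolute convergence along a wedge\<close>

lemma integrable_exp_minus_abs:
  assumes "\<kappa> > 0"
  shows "integrable lborel (\<lambda>r::real. exp (- \<kappa> * \<bar>r\<bar>))"
proof -
  have "(\<lambda>r. exp (- \<kappa> * \<bar>r\<bar>)) integrable_on {0..}"
    using integrable_on_exp_minus_to_infinity[OF assms, of 0]
    by (subst integrable_cong[where g = "\<lambda>r. exp (- \<kappa> * r)"]) auto
  then have "set_integrable lebesgue {0..} (\<lambda>r. exp (- \<kappa> * \<bar>r\<bar>))"
    by (subst absolutely_integrable_on_iff_nonneg) auto
  then have "integrable lborel (\<lambda>r. indicator {0..} r *\<^sub>R exp (- \<kappa> * \<bar>r\<bar>))"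
    unfolding set_integrable_def by (subst (asm) integrable_completion) auto
  from has_bochner_integral_even_function[OF has_bochner_integral_integrable[OF this]]
  show ?thesis by (auto simp: has_bochner_integral_iff)
qed

definition wedge_bounded :: "real \<Rightarrow> (complex \<Rightarrow> complex) \<Rightarrow> real \<Rightarrow> real \<Rightarrow> bool" where
  "wedge_bounded \<kappa> f a B \<longleftrightarrow> (\<forall>r. norm (f (wedge \<kappa> a r)) \<le> B * exp (- \<kappa> * \<bar>r\<bar>))"

lemma wedge_integrand_measurable:
  assumes "continuous_on (wedge_region \<kappa>) f" "a > 0"
  shows "(\<lambda>r. f (wedge \<kappa> a r) * wedge_deriv \<kappa> r) \<in> borel_measurable lborel"
proof -
  have "continuous_on UNIV (\<lambda>r. f (wedge \<kappa> a r))"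
    by (rule continuous_on_compose2[OF assms(1)]) (auto intro: continuous_intros simp: assms)
  then have [measurable]: "(\<lambda>r. f (wedge \<kappa> a r)) \<in> borel_measurable borel"
    by (rule borel_measurable_continuous_onI)
  have [measurable]: "wedge_deriv \<kappa> \<in> borel_measurable borel"
    unfolding wedge_deriv_eq[abs_def] by measurable
  show ?thesis by measurable
qed

lemma wedge_integrable:
  assumes "\<kappa> > 0" "a > 0" "continuous_on (wedge_region \<kappa>) f" and B: "wedge_bounded \<kappa> f a B"
  shows "integrable lborel (\<lambda>r. f (wedge \<kappa> a r) * wedge_deriv \<kappa> r)"
    and "norm (wedge_integral \<kappa> f a) \<le> B * ((1 + \<kappa>) * (LINT r|lborel. exp (- \<kappa> * \<bar>r\<bar>)))"
proof -
  let ?g = "\<lambda>r. B * ((1 + \<kappa>) * exp (- \<kappa> * \<bar>r\<bar>))"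
  have le: "norm (f (wedge \<kappa> a r) * wedge_deriv \<kappa> r) \<le> ?g r" for r
  proof -
    have "norm (f (wedge \<kappa> a r) * wedge_deriv \<kappa> r) \<le> (B * exp (- \<kappa> * \<bar>r\<bar>)) * (1 + \<kappa>)"
      unfolding norm_mult using B norm_wedge_deriv_le[of \<kappa> r] assms(1)
      by (intro mult_mono') (auto simp: wedge_bounded_def)
    then show ?thesis by (simp add: mult_ac)
  qed
  have int: "integrable lborel ?g"
    using integrable_exp_minus_abs[OF assms(1)] by simp
  show 1: "integrable lborel (\<lambda>r. f (wedge \<kappa> a r) * wedge_deriv \<kappa> r)"
    using le wedge_integrand_measurable[OF assms(3,2)]
    by (intro Bochner_Integration.integrable_bound[OF int] AE_I2)
      (auto intro: order_trans[OF _ abs_ge_self])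
  have "norm (wedge_integral \<kappa> f a) \<le> (LINT r|lborel. ?g r)"
    unfolding wedge_integral_def by (intro Bochner_Integration.integral_norm_bound_integral 1 int le)
  then show "norm (wedge_integral \<kappa> f a) \<le> B * ((1 + \<kappa>) * (LINT r|lborel. exp (- \<kappa> * \<bar>r\<bar>)))"
    by simp
qed

text \<open>The fundamental theorem of calculus on \<open>{- n..n}\<close>, with the corner as
  exceptional point, followed by dominated convergence.\<close>

lemma wedge_integral_primitive:
  assumes "\<kappa> > 0" "a > 0"
    and int: "integrable lborel (\<lambda>r. f (wedge \<kappa> a r) * wedge_deriv \<kappa> r)"
    and F: "\<And>s. s \<in> wedge_region \<kappa> \<Longrightarrow> (F has_field_derivative f s) (at s)"
  shows "(\<lambda>n. F (wedge \<kappa> a (real n)) - F (wedge \<kappa> a (- real n))) \<longlonglongrightarrow> wedge_integral \<kappa> f a"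
proof -
  define g where "g = (\<lambda>r. f (wedge \<kappa> a r) * wedge_deriv \<kappa> r)"
  have *: "(LINT r:{- real n..real n}|lborel. g r) = F (wedge \<kappa> a (real n)) - F (wedge \<kappa> a (- real n))" for n
  proof -
    have der: "((\<lambda>r. F (wedge \<kappa> a r)) has_vector_derivative g r) (at r)" if "r \<noteq> 0" for r
      using field_vector_diff_chain_at[OF wedge_has_vector_derivative[OF that, of \<kappa> a] F[of "wedge \<kappa> a r"]] assms(2)
      by (simp add: o_def g_def mult.commute)
    have "continuous_on (wedge_region \<kappa>) F"
      using F by (meson DERIV_isCont continuous_at_imp_continuous_on)
    then have cont: "continuous_on {- real n..real n} (\<lambda>r. F (wedge \<kappa> a r))"
      by (rule continuous_on_compose2) (auto intro: continuous_intros simp: assms)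
    have "(g has_integral (F (wedge \<kappa> a (real n)) - F (wedge \<kappa> a (- real n)))) {- real n..real n}"
      by (rule fundamental_theorem_of_calculus_interior_strong[of "{0}"]) (auto intro: der cont)
    moreover have "set_integrable lborel {- real n..real n} g"
      using int unfolding set_integrable_def g_def by (intro integrable_mult_indicator) auto
    ultimately show ?thesis
      by (metis set_borel_integral_eq_integral(2) integral_unique)
  qed
  have "(\<lambda>n. LINT r|lborel. indicator {- real n..real n} r *\<^sub>R g r) \<longlonglongrightarrow> (LINT r|lborel. g r)"
  proof (rule integral_dominated_convergence[where w = "\<lambda>r. norm (g r)"])
    show "g \<in> borel_measurable lborel" using int by (simp add: g_def)
    show "(\<lambda>r. indicator {- real n..real n} r *\<^sub>R g r) \<in> borel_measurable lborel" for n
      using int by (intro borel_measurable_scaleR) (auto simp: g_def)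
    show "integrable lborel (\<lambda>r. norm (g r))" using int by (simp add: g_def)
    show "AE r in lborel. (\<lambda>n. indicator {- real n..real n} r *\<^sub>R g r) \<longlonglongrightarrow> g r"
    proof (rule AE_I2)
      fix r :: real
      have "\<forall>\<^sub>F n in sequentially. \<bar>r\<bar> \<le> real n"
        using filterlim_real_sequentially by (simp add: filterlim_at_top)
      then have "\<forall>\<^sub>F n in sequentially. indicator {- real n..real n} r *\<^sub>R g r = g r"
        by eventually_elim (auto simp: indicator_def)
      then show "(\<lambda>n. indicator {- real n..real n} r *\<^sub>R g r) \<longlonglongrightarrow> g r"
        by (rule tendsto_eventually)
    qed
  qed (auto simp: indicator_def)
  then show ?thesis
    using * by (simp add: set_lebesgue_integral_def g_def wedge_integral_def)
qed

text \<open>Cauchy's theorem by way of a primitive \<open>F\<close>. The difference of the integrals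
  is the limit of \<open>G\<close> at the upper ends minus \<open>G\<close> at the lower ends, where
  \<open>G\<close> compares \<open>F\<close> on the two wedges at equal height. Each
  \<open>G r\<close> is a change of \<open>F\<close> over a horizontal segment of length
  \<open>a - b\<close>, on which \<open>f\<close> is exponentially small.\<close>

lemma wedge_integral_shift:
  assumes "\<kappa> > 0" "b > 0" "b \<le> a" and hol: "f holomorphic_on wedge_region \<kappa>"
    and B: "\<And>c. b \<le> c \<Longrightarrow> c \<le> a \<Longrightarrow> wedge_bounded \<kappa> f c B"
  shows "wedge_integral \<kappa> f a = wedge_integral \<kappa> f b"
proof -
  have cont: "continuous_on (wedge_region \<kappa>) f" using hol by (rule holomorphic_on_imp_continuous_on)
  have "\<exists>F. \<forall>s\<in>wedge_region \<kappa>. (F has_field_derivative f s) (at s)"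
    using hol open_wedge_region
    by (intro holomorphic_starlike_primitive[of _ f "{}"] cont starlike_wedge_region assms)
      (auto simp: holomorphic_on_open field_differentiable_def)
  then obtain F where F: "\<And>s. s \<in> wedge_region \<kappa> \<Longrightarrow> (F has_field_derivative f s) (at s)" by blast
  have a: "a > 0" using assms by simp
  define G where "G = (\<lambda>r. F (wedge \<kappa> a r) - F (wedge \<kappa> b r))"
  have G: "norm (G r) \<le> B * exp (- \<kappa> * \<bar>r\<bar>) * (a - b)" for r
  proof -
    have seg: "s \<in> wedge_region \<kappa> \<and> norm (f s) \<le> B * exp (- \<kappa> * \<bar>r\<bar>)"
      if s: "s \<in> closed_segment (wedge \<kappa> b r) (wedge \<kappa> a r)" for s
    proof -
      obtain u where u: "0 \<le> u" "u \<le> 1" "s = (1 - u) *\<^sub>R wedge \<kappa> b r + u *\<^sub>R wedge \<kappa> a r"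
        using s unfolding in_segment by metis
      \<comment> \<open>A point of the horizontal segment lies on the wedge with an intermediate
        vertex \<open>c\<close>, where the assumed bound applies.\<close>
      define c where "c = b + u * (a - b)"
      have "s = wedge \<kappa> c r" unfolding u(3) by (simp add: c_def complex_eq_iff algebra_simps)
      moreover have "b \<le> c" using u(1) assms(3) by (simp add: c_def)
      moreover have "u * (a - b) \<le> 1 * (a - b)" using u(2) assms(3) by (intro mult_right_mono) simp_all
      then have "c \<le> a" by (simp add: c_def)
      ultimately show ?thesis using B[of c] assms(2) by (simp add: wedge_bounded_def)
    qed
    have "norm (G r) \<le> B * exp (- \<kappa> * \<bar>r\<bar>) * norm (wedge \<kappa> a r - wedge \<kappa> b r)"
      unfolding G_def
    proof (rule field_differentiable_bound[where f = F and f' = f and S = "closed_segment (wedge \<kappa> b r) (wedge \<kappa> a r)"])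
      fix s assume "s \<in> closed_segment (wedge \<kappa> b r) (wedge \<kappa> a r)"
      with seg[of s] F[of s]
      show "(F has_field_derivative f s) (at s within closed_segment (wedge \<kappa> b r) (wedge \<kappa> a r))"
        and "norm (f s) \<le> B * exp (- \<kappa> * \<bar>r\<bar>)"
        by (simp_all add: has_field_derivative_at_within)
    qed simp_all
    moreover have "wedge \<kappa> a r - wedge \<kappa> b r = of_real (a - b)" by (simp add: complex_eq_iff)
    ultimately show ?thesis using assms(3) by (simp only: norm_of_real)
  qed
  have "(\<lambda>n. exp (- \<kappa> * real n)) \<longlonglongrightarrow> 0"
    using assms(1) by real_asymp
  then have lim: "(\<lambda>n. B * exp (- \<kappa> * real n) * (a - b)) \<longlonglongrightarrow> 0"
    by (intro tendsto_mult_right_zero tendsto_mult_left_zero)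
  have "(\<lambda>n. G (real n)) \<longlonglongrightarrow> 0" "(\<lambda>n. G (- real n)) \<longlonglongrightarrow> 0"
    by (rule Lim_null_comparison[OF always_eventually lim], use G[of "real _"] in simp,
        rule Lim_null_comparison[OF always_eventually lim], use G[of "- real _"] in simp)
  then have "(\<lambda>n. G (real n) - G (- real n)) \<longlonglongrightarrow> 0 - 0" by (rule tendsto_diff)
  moreover have "(\<lambda>n. G (real n) - G (- real n)) \<longlonglongrightarrow> wedge_integral \<kappa> f a - wedge_integral \<kappa> f b"
    using tendsto_diff[OF
      wedge_integral_primitive[OF assms(1) a wedge_integrable(1)[OF assms(1) a cont B] F]
      wedge_integral_primitive[OF assms(1,2) wedge_integrable(1)[OF assms(1,2) cont B] F]] assms
    by (simp add: G_def algebra_simps)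
  ultimately show ?thesis using LIMSEQ_unique by fastforce
qed

text \<open>A primitive that itself decays has boundary values tending to 0 at both ends.\<close>

lemma wedge_integral_eq_0:
  assumes "\<kappa> > 0" "a > 0" "continuous_on (wedge_region \<kappa>) f" "wedge_bounded \<kappa> f a B"
    and F: "\<And>s. s \<in> wedge_region \<kappa> \<Longrightarrow> (F has_field_derivative f s) (at s)"
    and "wedge_bounded \<kappa> F a C"
  shows "wedge_integral \<kappa> f a = 0"
proof -
  have "(\<lambda>n. exp (- \<kappa> * real n)) \<longlonglongrightarrow> 0"
    using assms(1) by real_asymp
  then have lim: "(\<lambda>n. C * exp (- \<kappa> * real n)) \<longlonglongrightarrow> 0"
    by (rule tendsto_mult_right_zero)
  have "(\<lambda>n. F (wedge \<kappa> a (real n))) \<longlonglongrightarrow> 0" "(\<lambda>n. F (wedge \<kappa> a (- real n))) \<longlonglongrightarrow> 0"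
    by (rule Lim_null_comparison[OF always_eventually lim],
        use assms(6)[unfolded wedge_bounded_def, rule_format, of "real _"] in simp,
        rule Lim_null_comparison[OF always_eventually lim],
        use assms(6)[unfolded wedge_bounded_def, rule_format, of "- real _"] in simp)
  then have "(\<lambda>n. F (wedge \<kappa> a (real n)) - F (wedge \<kappa> a (- real n))) \<longlonglongrightarrow> 0 - 0"
    by (rule tendsto_diff)
  then show ?thesis
    using LIMSEQ_unique[OF wedge_integral_primitive[OF assms(1,2) wedge_integrable(1)[OF assms(1-4)] F]]
    by simp
qed

section \<open>Hankel's integral for the reciprocal Gamma function\<close>

text \<open>Euler's integral after the substitution \<open>t = m * r\<close>.\<close>

lemma has_bochner_integral_Gamma_scaled:
  fixes q m :: real
  assumes "q > 0" "m > 0"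
  shows "has_bochner_integral lborel (\<lambda>r. indicator {0..} r *\<^sub>R (r powr (q - 1) * exp (- m * r)))
           (Gamma q * m powr (- q))"
proof -
  let ?f = "\<lambda>t::real. indicator {0..} t * t powr (q - 1) / exp t"
  have "has_bochner_integral lborel ?f (Gamma q)"
    using Gamma_conv_nn_integral_real[OF assms(1)] Gamma_real_pos[OF assms(1)]
    by (intro has_bochner_integral_nn_integral) auto
  then have "has_bochner_integral lborel (\<lambda>r. ?f (0 + m * r)) (Gamma q /\<^sub>R \<bar>m\<bar>)"
    using lborel_has_bochner_integral_real_affine_iff[of m ?f "Gamma q" 0] assms by simp
  then have "has_bochner_integral lborel (\<lambda>r. m powr (1 - q) * ?f (0 + m * r)) (m powr (1 - q) * (Gamma q /\<^sub>R \<bar>m\<bar>))"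
    by (rule has_bochner_integral_mult_right)
  also have "(\<lambda>r. m powr (1 - q) * ?f (0 + m * r)) = (\<lambda>r. indicator {0..} r *\<^sub>R (r powr (q - 1) * exp (- m * r)))"
  proof
    fix r :: real
    have "m powr (1 - q) * m powr (q - 1) = 1" using assms by (simp flip: powr_add)
    then have "m powr (1 - q) * (m powr (q - 1) * z) = z" for z by (metis mult.assoc mult_1)
    moreover have "0 \<le> m * r \<longleftrightarrow> 0 \<le> r" using assms by (simp add: zero_le_mult_iff)
    ultimately show "m powr (1 - q) * ?f (0 + m * r) = indicator {0..} r *\<^sub>R (r powr (q - 1) * exp (- m * r))"
      using assms by (simp add: indicator_def powr_mult exp_minus field_simps)
  qed
  also have "m powr (1 - q) * (Gamma q /\<^sub>R \<bar>m\<bar>) = Gamma q * m powr (- q)"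
    using assms by (simp add: powr_diff powr_minus field_simps)
  finally show ?thesis .
qed

text \<open>The complex rate \<open>c\<close> is reached by expansion around a real rate
  \<open>m\<close>: with \<open>w = m - c\<close>, the factor \<open>exp (w * r)\<close> is expanded
  in powers, integrated term by term against \<open>exp (- m * r)\<close>, and the results add up to
  the binomial series of \<open>(1 - w / m) powr (- q)\<close>.\<close>

lemma has_bochner_integral_Gamma_rotated:
  fixes c :: complex
  assumes q: "q > 0" and c: "Re c > 0"
  shows "has_bochner_integral lborel (\<lambda>r. indicator {0..} r *\<^sub>R (of_real (r powr (q - 1)) * exp (- c * of_real r)))
           (Gamma (of_real q) * c powr (- of_real q))"
proof -
  \<comment> \<open>This choice gives \<open>m * Re c = (norm c)\<^sup>2\<close>, hence
    \<open>(norm w)\<^sup>2 = m\<^sup>2 - (norm c)\<^sup>2 < m\<^sup>2\<close>, so both the binomial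
    series and the majorant converge.\<close>
  define m where "m = (norm c)\<^sup>2 / Re c"
  define w where "w = of_real m - c"
  have "norm c > 0" using c by auto
  then have m: "m > 0" using c by (simp add: m_def)
  have "(norm w)\<^sup>2 = m\<^sup>2 - m * Re c + ((norm c)\<^sup>2 - m * Re c)"
    unfolding cmod_power2 by (simp add: w_def power2_eq_square algebra_simps)
  also have "\<dots> < m\<^sup>2" using c \<open>norm c > 0\<close> by (simp add: m_def)
  finally have w: "norm w < m" using m by (simp add: power_less_imp_less_base)
  define f where "f = (\<lambda>k r. indicator {0..} r *\<^sub>R
     (of_real (r powr (q - 1) * exp (- m * r)) * ((w * of_real r) ^ k / fact k)))"
  define g where "g = (\<lambda>r::real. indicator {0..} r *\<^sub>R (of_real (r powr (q - 1)) * exp (- c * of_real r)))"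
  define I where "I = (\<lambda>k. Gamma (of_real q) * of_real m powr (- of_real q) * ((- of_real q gchoose k) * (- (w / of_real m)) ^ k))"
  have f: "has_bochner_integral lborel (f k) (I k)" for k
  proof -
    have "has_bochner_integral lborel
       (\<lambda>r. w ^ k / fact k * of_real (indicator {0..} r *\<^sub>R (r powr ((q + real k) - 1) * exp (- m * r))))
       (w ^ k / fact k * of_real (Gamma (q + real k) * m powr (- (q + real k))))"
      using q m by (intro has_bochner_integral_mult_right has_bochner_integral_of_real has_bochner_integral_Gamma_scaled) auto
    also have "(\<lambda>r. w ^ k / fact k * of_real (indicator {0..} r *\<^sub>R (r powr ((q + real k) - 1) * exp (- m * r)))) = f k"
    proof
      fix r :: real
      have "r powr (q + real k - 1) = r powr (q - 1) * r ^ k" if "r > 0"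
        using that by (simp add: powr_add[symmetric] powr_realpow[symmetric] algebra_simps)
      moreover have "r powr (q + real k - 1) = r powr (q - 1) * r ^ k" if "r = 0" using that by simp
      ultimately show "w ^ k / fact k * of_real (indicator {0..} r *\<^sub>R (r powr ((q + real k) - 1) * exp (- m * r))) = f k r"
        by (cases r "0::real" rule: linorder_cases) (auto simp: f_def indicator_def power_mult_distrib)
    qed
    also have "w ^ k / fact k * of_real (Gamma (q + real k) * m powr (- (q + real k))) = I k"
    proof -
      have "complex_of_real q \<notin> \<int>\<^sub>\<le>\<^sub>0" using q by (auto elim!: nonpos_Ints_cases simp: complex_eq_iff)
      then have "complex_of_real (Gamma (q + real k)) = pochhammer (of_real q) k * Gamma (of_real q)"
        using pochhammer_Gamma[of "complex_of_real q" k]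
        by (simp add: Gamma_eq_zero_iff Gamma_complex_of_real[symmetric])
      moreover have "m powr (- (q + real k)) = m powr (- q) / m ^ k"
        using m by (simp add: powr_diff powr_realpow)
      ultimately show ?thesis
        using m powr_of_real[of m "- q"] by (simp add: I_def gbinomial_pochhammer power_divide power_minus')
    qed
    finally show ?thesis .
  qed
  have fint: "integrable lborel (f k)" "integral\<^sup>L lborel (f k) = I k" for k
    using f[of k] by (simp_all add: has_bochner_integral_iff)
  have bound: "integrable lborel (\<lambda>r. indicator {0..} r *\<^sub>R (r powr (q - 1) * exp (- (m - norm w) * r)))"
    using has_bochner_integral_Gamma_scaled[OF q, of "m - norm w"] w by (simp add: has_bochner_integral_iff)
  have g_meas: "g \<in> borel_measurable lborel" unfolding g_def by measurable
  have lim: "(\<lambda>n. \<Sum>k<n. f k r) \<longlonglongrightarrow> g r" for r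
  proof -
    have "(\<lambda>k. (w * of_real r) ^ k / fact k) sums exp (w * of_real r)"
      using exp_converges[of "w * of_real r"] by (simp add: scaleR_conv_of_real field_simps)
    then have "(\<lambda>k. f k r) sums (indicator {0..} r *\<^sub>R (of_real (r powr (q - 1) * exp (- m * r)) * exp (w * of_real r)))"
      unfolding f_def by (intro sums_scaleR_right sums_mult)
    moreover have "complex_of_real (exp (- m * r)) * exp (w * of_real r) = exp (- c * of_real r)"
      by (simp add: exp_of_real[symmetric] exp_add[symmetric] w_def algebra_simps)
    ultimately show ?thesis by (simp add: sums_def g_def mult.assoc)
  qed
  \<comment> \<open>Partial sums of \<open>exp (w * r)\<close> are at most
    \<open>exp (norm w * r)\<close>, and \<open>norm w < m\<close> leaves exponential decay for
    dominated convergence.\<close>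
  have le: "norm (\<Sum>k<n. f k r) \<le> indicator {0..} r *\<^sub>R (r powr (q - 1) * exp (- (m - norm w) * r))" for n r
  proof (cases "r \<ge> 0")
    case True
    have "norm (\<Sum>k<n. (w * of_real r) ^ k / fact k) \<le> (\<Sum>k<n. (norm w * r) ^ k / fact k)"
      using True by (intro sum_norm_le) (simp add: norm_divide norm_power norm_mult)
    also have "\<dots> \<le> exp (norm w * r)"
      using exp_converges[of "norm w * r"] True
      by (intro sum_le_suminf[THEN order_trans[OF _ eq_refl[OF sums_unique[symmetric]]]])
        (auto simp: sums_iff divide_inverse mult_ac)
    finally have "norm (\<Sum>k<n. (w * of_real r) ^ k / fact k) \<le> exp (norm w * r)" .
    moreover have "(\<Sum>k<n. f k r) = of_real (r powr (q - 1) * exp (- m * r)) * (\<Sum>k<n. (w * of_real r) ^ k / fact k)"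
      using True by (simp add: f_def sum_distrib_left)
    ultimately have "norm (\<Sum>k<n. f k r) \<le> r powr (q - 1) * exp (- m * r) * exp (norm w * r)"
      by (simp add: norm_mult mult_left_mono)
    also have "\<dots> = r powr (q - 1) * exp (- (m - norm w) * r)"
      by (simp add: exp_add[symmetric] algebra_simps)
    finally show ?thesis using True by simp
  qed (simp add: f_def)
  have "g \<in> borel_measurable lborel" "\<And>n. (\<lambda>r. \<Sum>k<n. f k r) \<in> borel_measurable lborel"
    using g_meas fint(1) by (auto intro!: borel_measurable_sum)
  note dom = this bound AE_I2[OF lim] AE_I2[OF le]
  have "(\<lambda>n. LINT r|lborel. (\<Sum>k<n. f k r)) \<longlonglongrightarrow> integral\<^sup>L lborel g"
    by (rule integral_dominated_convergence[OF dom])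
  then have "I sums integral\<^sup>L lborel g"
    using fint by (simp add: sums_def Bochner_Integration.integral_sum)
  moreover have "I sums (Gamma (of_real q) * c powr (- of_real q))"
  proof -
    have "norm (- (w / of_real m)) < 1" using w m by (simp add: norm_divide)
    from gen_binomial_complex[OF this, of "- of_real q"]
    have "I sums (Gamma (of_real q) * of_real m powr (- of_real q) * (1 + - (w / of_real m)) powr (- of_real q))"
      unfolding I_def by (rule sums_mult)
    moreover have "of_real m powr (- of_real q) * (1 + - (w / of_real m)) powr (- of_real q)
        = c powr (- of_real q :: complex)"
      using m by (subst powr_times_real_left[symmetric]) (simp_all add: w_def field_simps)
    ultimately show ?thesis by (simp add: mult.assoc)
  qed
  ultimately have "integral\<^sup>L lborel g = Gamma (of_real q) * c powr (- of_real q)"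
    by (rule sums_unique2)
  moreover have "integrable lborel g" by (rule integrable_dominated_convergence[OF dom])
  ultimately show ?thesis by (simp add: has_bochner_integral_iff g_def)
qed

section \<open>The Hankel integrand and its independence of the vertex\<close>

definition hankel_integrand :: "real \<Rightarrow> complex \<Rightarrow> complex" where
  "hankel_integrand x s = exp s * s powr (- of_real x)"

lemma wedge_region_nonpos_Reals: "s \<in> wedge_region \<kappa> \<Longrightarrow> s \<notin> \<real>\<^sub>\<le>\<^sub>0"
  by (auto simp: wedge_region_def complex_nonpos_Reals_iff)

lemma hankel_integrand_holomorphic: "hankel_integrand x holomorphic_on wedge_region \<kappa>"
  unfolding hankel_integrand_def[abs_def]
  by (intro holomorphic_intros) (auto dest: wedge_region_nonpos_Reals)

text \<open>The modulus of \<open>exp s\<close> depends on \<open>Re s\<close> only. The constant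
  involves an upper bound \<open>b\<close> of the vertex, so it can be shared by all wedges of a
  shift.\<close>

lemma wedge_bounded_exp_mult:
  assumes "\<And>r. norm (g (wedge \<kappa> a r)) \<le> M" "a \<le> b"
  shows "wedge_bounded \<kappa> (\<lambda>s. exp s * g s) a (exp b * M)"
  unfolding wedge_bounded_def
proof
  fix r
  have M: "M \<ge> 0" using assms(1)[of 0] norm_ge_zero order_trans by blast
  have "norm (exp (wedge \<kappa> a r) * g (wedge \<kappa> a r)) \<le> exp (a - \<kappa> * \<bar>r\<bar>) * M"
    using assms by (simp add: norm_mult mult_left_mono)
  also have "\<dots> \<le> exp (b - \<kappa> * \<bar>r\<bar>) * M" using assms M by (intro mult_right_mono) auto
  finally show "norm (exp (wedge \<kappa> a r) * g (wedge \<kappa> a r)) \<le> exp b * M * exp (- \<kappa> * \<bar>r\<bar>)"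
    by (simp add: exp_diff exp_minus field_simps)
qed

lemma norm_wedge_powr_le:
  assumes "\<kappa> > 0" "b > 0" "b \<le> a" "x \<ge> 0"
  shows "norm (wedge \<kappa> a r powr (- of_real x)) \<le> (b / (1 + \<kappa>)) powr (- x)"
proof -
  have "b / (1 + \<kappa>) \<le> a / (1 + \<kappa>)" using assms by (simp add: divide_right_mono)
  then have "b / (1 + \<kappa>) \<le> norm (wedge \<kappa> a r)" using wedge_norm_ge(1)[OF assms(1), of a r] by linarith
  moreover have "norm (wedge \<kappa> a r powr (- of_real x)) = norm (wedge \<kappa> a r) powr (- x)"
    by (subst norm_powr_real_powr') auto
  ultimately show ?thesis using assms by (auto intro!: powr_mono2')
qed

lemma hankel_integrand_bounded:
  assumes "\<kappa> > 0" "b > 0" "b \<le> c" "c \<le> a" "x \<ge> 0"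
  shows "wedge_bounded \<kappa> (hankel_integrand x) c (exp a * (b / (1 + \<kappa>)) powr (- x))"
  unfolding hankel_integrand_def[abs_def]
  by (rule wedge_bounded_exp_mult) (use norm_wedge_powr_le assms in auto)

lemma hankel_integrable:
  assumes "\<kappa> > 0" "a > 0" "x \<ge> 0"
  shows "integrable lborel (\<lambda>r. hankel_integrand x (wedge \<kappa> a r) * wedge_deriv \<kappa> r)"
  using assms hankel_integrand_bounded[of \<kappa> a a a x]
  by (intro wedge_integrable holomorphic_on_imp_continuous_on hankel_integrand_holomorphic) auto

lemma hankel_shift:
  assumes "\<kappa> > 0" "a > 0" "b > 0" "x \<ge> 0"
  shows "wedge_integral \<kappa> (hankel_integrand x) a = wedge_integral \<kappa> (hankel_integrand x) b"
  using wedge_integral_shift[OF assms(1,3) _ hankel_integrand_holomorphic hankel_integrand_bounded[OF assms(1,3) _ _ assms(4)]]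
    wedge_integral_shift[OF assms(1,2) _ hankel_integrand_holomorphic hankel_integrand_bounded[OF assms(1,2) _ _ assms(4)]]
  by (metis linear)

section \<open>Evaluation of Hankel's integral\<close>

lemma rotated_powr_eq:
  assumes "Im u > 0"
  shows "u powr q * (- u) powr (- q) = exp (\<i> * pi * q)"
    and "cnj u powr q * (- cnj u) powr (- q) = exp (- (\<i> * pi * q))"
proof -
  have "u \<noteq> 0" using assms by auto
  \<comment> \<open>Above the real axis the principal branch satisfies
    \<open>Ln (- u) = Ln u - \<i> * pi\<close>; this fixes the sign of the phase.\<close>
  then show "u powr q * (- u) powr (- q) = exp (\<i> * pi * q)"
    using assms by (simp add: powr_def exp_add[symmetric] Ln_minus algebra_simps)
  show "cnj u powr q * (- cnj u) powr (- q) = exp (- (\<i> * pi * q))"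
    using assms \<open>u \<noteq> 0\<close> by (simp add: powr_def exp_add[symmetric] exp_minus[symmetric] Ln_minus algebra_simps)
qed

text \<open>With vertex 0 the arms are rays from the origin, each a rotated Gamma integral with
  exponent \<open>1 - x > 0\<close>. Their phases combine to
  \<open>2 * \<i> * sin (pi * (1 - x))\<close>, and the reflection formula turns
  \<open>Gamma (1 - x)\<close> into \<open>rGamma x\<close>.\<close>

lemma hankel_integral_vertex_0:
  assumes "\<kappa> > 0" "0 < x" "x < 1"
  shows "has_bochner_integral lborel (\<lambda>r. hankel_integrand x (wedge \<kappa> 0 r) * wedge_deriv \<kappa> r)
           (2 * of_real pi * \<i> * rGamma (of_real x))"
proof -
  define u where "u = Complex (- \<kappa>) 1"
  define q where "q = 1 - x"
  define g where "g = (\<lambda>r. hankel_integrand x (wedge \<kappa> 0 r) * wedge_deriv \<kappa> r)"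
  define I where "I = (\<lambda>r. indicator {0..} r *\<^sub>R of_real (r powr (q - 1)) :: complex)"
  have q: "q > 0" using assms by (simp add: q_def)
  \<comment> \<open>Since \<open>0 powr _ = 0\<close>, both half-lines may contain the point 0
    without counting it twice.\<close>
  have g0: "g 0 = 0" by (simp add: g_def hankel_integrand_def wedge_eq)
  have ray: "hankel_integrand x (of_real r * v) = of_real (r powr (q - 1)) * exp (v * of_real r) * v powr (of_real q - 1)"
    if "r > 0" for r v
  proof -
    have "(of_real r * v) powr (- of_real x) = of_real r powr (- of_real x) * v powr (- of_real x)"
      using that by (intro powr_times_real_left) auto
    then show ?thesis
      using that powr_of_real[of r "- x"] by (simp add: hankel_integrand_def q_def mult_ac)
  qed
  have ray_integral: "has_bochner_integral lborel (\<lambda>r. indicator {0..} r *\<^sub>R (hankel_integrand x (of_real r * v) * v))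
      (Gamma (of_real q) * (v powr of_real q * (- v) powr (- of_real q)))" if "Re v < 0" for v
  proof -
    have v: "v \<noteq> 0" using that by auto
    have "has_bochner_integral lborel
       (\<lambda>r. v powr (of_real q) * (indicator {0..} r *\<^sub>R (of_real (r powr (q - 1)) * exp (- (- v) * of_real r))))
       (v powr (of_real q) * (Gamma (of_real q) * (- v) powr (- of_real q)))"
      using that q by (intro has_bochner_integral_mult_right has_bochner_integral_Gamma_rotated) auto
    also have "(\<lambda>r. v powr (of_real q) * (indicator {0..} r *\<^sub>R (of_real (r powr (q - 1)) * exp (- (- v) * of_real r))))
        = (\<lambda>r. indicator {0..} r *\<^sub>R (hankel_integrand x (of_real r * v) * v))"
    proof
      fix r :: real
      have "v powr of_real q = v powr (of_real q - 1) * v" using v by (simp add: powr_diff)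
      then have "v powr (of_real q) * (of_real (r powr (q - 1)) * exp (- (- v) * of_real r)) = hankel_integrand x (of_real r * v) * v" if "r > 0"
        using ray[OF that, of v] by (simp add: mult_ac)
      moreover have "hankel_integrand x (of_real r * v) * v = 0" if "r = 0" using that by (simp add: hankel_integrand_def)
      ultimately show "v powr (of_real q) * (indicator {0..} r *\<^sub>R (of_real (r powr (q - 1)) * exp (- (- v) * of_real r)))
          = indicator {0..} r *\<^sub>R (hankel_integrand x (of_real r * v) * v)"
        by (cases r "0::real" rule: linorder_cases) auto
    qed
    finally show ?thesis by (simp add: mult_ac)
  qed
  have "has_bochner_integral lborel (\<lambda>r. indicator {0..} r *\<^sub>R g r) (Gamma (of_real q) * exp (\<i> * pi * of_real q))"
  proof -
    have "indicator {0..} r *\<^sub>R (hankel_integrand x (of_real r * u) * u) = indicator {0..} r *\<^sub>R g r" for r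
    proof -
      have "wedge \<kappa> 0 r = of_real r * u" "wedge_deriv \<kappa> r = u" if "r > 0"
        using that by (simp_all add: u_def complex_eq_iff wedge_deriv_def)
      then show ?thesis
        by (cases r "0::real" rule: linorder_cases) (auto simp: g0 hankel_integrand_def, auto simp: g_def hankel_integrand_def)
    qed
    then have "(\<lambda>r. indicator {0..} r *\<^sub>R (hankel_integrand x (of_real r * u) * u)) = (\<lambda>r. indicator {0..} r *\<^sub>R g r)"
      by (rule ext)
    moreover have "Re u < 0" "Im u > 0" using assms(1) by (simp_all add: u_def)
    ultimately show ?thesis
      using ray_integral[of u] rotated_powr_eq(1)[of u "of_real q"] by (simp only:)
  qed
  moreover have "has_bochner_integral lborel (\<lambda>r. indicator {..0} r *\<^sub>R g r) (- (Gamma (of_real q) * exp (- (\<i> * pi * of_real q))))"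
  proof -
    \<comment> \<open>The lower arm is the ray through \<open>cnj u\<close> traversed towards the
      origin, whence the reflection of \<open>r\<close> and the minus sign.\<close>
    have "- (indicator {0..} (- r) *\<^sub>R (hankel_integrand x (of_real (- r) * cnj u) * cnj u)) = indicator {..0} r *\<^sub>R g r" for r
    proof -
      have "wedge \<kappa> 0 r = of_real (- r) * cnj u" "wedge_deriv \<kappa> r = - cnj u" if "r < 0"
        using that by (simp_all add: u_def complex_eq_iff wedge_deriv_def)
      then show ?thesis
        by (cases r "0::real" rule: linorder_cases) (auto simp: g0 hankel_integrand_def, auto simp: g_def hankel_integrand_def)
    qed
    moreover have "has_bochner_integral lborel
        (\<lambda>r. - (indicator {0..} (- r) *\<^sub>R (hankel_integrand x (of_real (- r) * cnj u) * cnj u)))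
        (- (Gamma (of_real q) * (cnj u powr of_real q * (- cnj u) powr (- of_real q))))"
      using lborel_has_bochner_integral_real_affine_iff[where c = "-1" and t = 0, THEN iffD1, OF _ ray_integral[of "cnj u"]] assms(1)
      by (intro has_bochner_integral_minus) (simp add: u_def)
    ultimately show ?thesis
      using rotated_powr_eq(2)[of u "of_real q"] by (simp add: u_def)
  qed
  ultimately have "has_bochner_integral lborel (\<lambda>r. indicator {0..} r *\<^sub>R g r + indicator {..0} r *\<^sub>R g r)
      (Gamma (of_real q) * exp (\<i> * pi * of_real q) + - (Gamma (of_real q) * exp (- (\<i> * pi * of_real q))))"
    by (rule has_bochner_integral_add)
  also have "(\<lambda>r. indicator {0..} r *\<^sub>R g r + indicator {..0} r *\<^sub>R g r) = g"
  proof
    show "indicator {0..} r *\<^sub>R g r + indicator {..0} r *\<^sub>R g r = g r" for r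
      by (cases r "0::real" rule: linorder_cases) (auto simp: g0)
  qed
  also have "Gamma (of_real q) * exp (\<i> * pi * of_real q) + - (Gamma (of_real q) * exp (- (\<i> * pi * of_real q)))
      = Gamma (of_real q) * (2 * \<i> * sin (of_real pi * of_real q))"
    by (simp add: sin_exp_eq mult_ac) (simp add: field_simps)
  also have "\<dots> = 2 * of_real pi * \<i> * rGamma (of_real x)"
  proof -
    have "complex_of_real q \<notin> \<int>\<^sub>\<le>\<^sub>0" using q by (auto elim!: nonpos_Ints_cases simp: complex_eq_iff)
    then have "rGamma (of_real q) * Gamma (complex_of_real q) = 1"
      by (simp add: rGamma_inverse_Gamma Gamma_eq_zero_iff)
    moreover have "sin (of_real pi * complex_of_real q) = of_real pi * (rGamma (of_real q) * rGamma (of_real x))"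
      using rGamma_reflection_complex[of "of_real q"] by (simp add: q_def)
    ultimately show ?thesis by (simp add: algebra_simps)
  qed
  finally show ?thesis by (simp add: g_def)
qed

text \<open>The integral is the same for all positive vertices, so it equals its limit as the vertex
  tends to 0; for \<open>x < 1\<close> the singularity arising there is integrable.\<close>

lemma hankel_integral_less_1:
  assumes "\<kappa> > 0" "a > 0" "0 < x" "x < 1"
  shows "wedge_integral \<kappa> (hankel_integrand x) a = 2 * of_real pi * \<i> * rGamma (of_real x)"
proof -
  define b where "b = (\<lambda>n. inverse (real (Suc n)))"
  have b: "b n > 0" "b n \<le> 1" for n by (simp_all add: b_def inverse_le_1_iff)
  have lim_b: "b \<longlonglongrightarrow> 0" unfolding b_def by (rule LIMSEQ_inverse_real_of_nat)
  \<comment> \<open>For vertices at most 1, \<open>exp\<close> contributes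
    \<open>exp 1 * exp (- \<kappa> * \<bar>r\<bar>)\<close>, the power at most
    \<open>\<bar>r\<bar> powr (- x)\<close> and the derivative at most \<open>1 + \<kappa>\<close>.
    The exponent is written to match the Gamma integral.\<close>
  define w where "w = (\<lambda>r::real. exp 1 * (1 + \<kappa>) * (\<bar>r\<bar> powr ((1 - x) - 1) * exp (- \<kappa> * \<bar>r\<bar>)))"
  have "has_bochner_integral lborel (\<lambda>r. indicator {0..} r *\<^sub>R (\<bar>r\<bar> powr ((1 - x) - 1) * exp (- \<kappa> * \<bar>r\<bar>)))
          (Gamma (1 - x) * \<kappa> powr (- (1 - x)))"
  proof -
    have "(\<lambda>r. indicator {0..} r *\<^sub>R (\<bar>r\<bar> powr ((1 - x) - 1) * exp (- \<kappa> * \<bar>r\<bar>)))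
        = (\<lambda>r. indicator {0..} r *\<^sub>R (r powr ((1 - x) - 1) * exp (- \<kappa> * r)))"
      by (auto simp: fun_eq_iff indicator_def)
    then show ?thesis
      using has_bochner_integral_Gamma_scaled[of "1 - x" \<kappa>] assms by (simp only:)
  qed
  from has_bochner_integral_even_function[OF this]
  have w: "integrable lborel w"
    unfolding w_def by (auto simp: has_bochner_integral_iff)
  let ?h = "\<lambda>a r. hankel_integrand x (wedge \<kappa> a r) * wedge_deriv \<kappa> r"
  have "(\<lambda>n. LINT r|lborel. ?h (b n) r) \<longlonglongrightarrow> (LINT r|lborel. ?h 0 r)"
  proof (rule integral_dominated_convergence[OF _ _ w])
    show "?h 0 \<in> borel_measurable lborel"
      using hankel_integral_vertex_0[OF assms(1,3,4)] by (auto simp: has_bochner_integral_iff)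
    show "?h (b n) \<in> borel_measurable lborel" for n
      using hankel_integrable[OF assms(1) b(1), of x n] assms by auto
    show "AE r in lborel. (\<lambda>n. ?h (b n) r) \<longlonglongrightarrow> ?h 0 r"
      using AE_lborel_singleton[of 0]
    proof eventually_elim
      fix r :: real assume "r \<noteq> 0"
      then have "wedge \<kappa> 0 r \<notin> \<real>\<^sub>\<le>\<^sub>0" by (auto simp: complex_nonpos_Reals_iff)
      then have "isCont (hankel_integrand x) (wedge \<kappa> 0 r)"
        unfolding hankel_integrand_def[abs_def] by (intro continuous_intros) auto
      moreover have "(\<lambda>n. wedge \<kappa> (b n) r) \<longlonglongrightarrow> wedge \<kappa> 0 r"
        unfolding wedge_eq by (intro tendsto_intros lim_b)
      ultimately have "(\<lambda>n. hankel_integrand x (wedge \<kappa> (b n) r)) \<longlonglongrightarrow> hankel_integrand x (wedge \<kappa> 0 r)"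
        by (rule isCont_tendsto_compose)
      then show "(\<lambda>n. ?h (b n) r) \<longlonglongrightarrow> ?h 0 r" by (rule tendsto_mult_right)
    qed
    show "AE r in lborel. norm (?h (b n) r) \<le> w r" for n
      using AE_lborel_singleton[of 0]
    proof eventually_elim
      fix r :: real assume r: "r \<noteq> 0"
      have "norm (wedge \<kappa> (b n) r powr (- of_real x)) = norm (wedge \<kappa> (b n) r) powr (- x)"
        by (subst norm_powr_real_powr') auto
      also have "\<dots> \<le> \<bar>r\<bar> powr (- x)"
        using wedge_norm_ge(2)[OF assms(1), of r "b n"] r assms by (intro powr_mono2') auto
      finally have "norm (?h (b n) r) \<le> exp (b n - \<kappa> * \<bar>r\<bar>) * \<bar>r\<bar> powr (- x) * (1 + \<kappa>)"
        unfolding norm_mult hankel_integrand_def using norm_wedge_deriv_le[of \<kappa> r] assms(1)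
        by (intro mult_mono) auto
      also have "\<dots> \<le> exp (1 - \<kappa> * \<bar>r\<bar>) * \<bar>r\<bar> powr (- x) * (1 + \<kappa>)"
        using b(2)[of n] assms(1) by (intro mult_right_mono) auto
      also have "\<dots> = w r" by (simp add: w_def exp_diff exp_minus field_simps)
      finally show "norm (?h (b n) r) \<le> w r" .
    qed
  qed
  moreover have "(LINT r|lborel. ?h (b n) r) = wedge_integral \<kappa> (hankel_integrand x) a" for n
    using hankel_shift[OF assms(1,2) b(1), of x n] assms by (simp add: wedge_integral_def)
  ultimately have "wedge_integral \<kappa> (hankel_integrand x) a = (LINT r|lborel. ?h 0 r)"
    by (simp add: LIMSEQ_const_iff)
  then show ?thesis
    using hankel_integral_vertex_0[OF assms(1,3,4)] by (simp add: has_bochner_integral_iff)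
qed

text \<open>At \<open>x = 1\<close> the integrand with vertex 0 is no longer integrable, so this
  value is obtained as a limit from \<open>x < 1\<close> at a fixed vertex.\<close>

lemma hankel_integral_1:
  assumes "\<kappa> > 0" "a > 0"
  shows "wedge_integral \<kappa> (hankel_integrand 1) a = 2 * of_real pi * \<i> * rGamma 1"
proof -
  define x where "x = (\<lambda>n. 1 - inverse (real (Suc (Suc n))))"
  have x: "0 < x n" "x n < 1" for n by (simp_all add: x_def field_simps)
  have "x \<longlonglongrightarrow> 1 - 0"
    unfolding x_def by (intro tendsto_diff tendsto_const LIMSEQ_Suc[OF LIMSEQ_inverse_real_of_nat])
  then have lim_x: "x \<longlonglongrightarrow> 1" by simp
  \<comment> \<open>On the wedge with vertex \<open>1 + \<kappa>\<close> the modulus is at least 1,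
    so all the powers are bounded by 1 uniformly in \<open>x\<close>.\<close>
  let ?h = "\<lambda>x r. hankel_integrand x (wedge \<kappa> (1 + \<kappa>) r) * wedge_deriv \<kappa> r"
  have a: "1 + \<kappa> > 0" using assms by simp
  have bd: "wedge_bounded \<kappa> (hankel_integrand (x n)) (1 + \<kappa>) (exp (1 + \<kappa>))" for n
    using hankel_integrand_bounded[OF assms(1) a order.refl order.refl, of "x n"] x[of n] assms by simp
  have "(\<lambda>n. LINT r|lborel. ?h (x n) r) \<longlonglongrightarrow> (LINT r|lborel. ?h 1 r)"
  proof (rule integral_dominated_convergence)
    show "integrable lborel (\<lambda>r. exp (1 + \<kappa>) * exp (- \<kappa> * \<bar>r\<bar>) * (1 + \<kappa>))"
      using integrable_exp_minus_abs[OF assms(1)] by simp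
    show "?h 1 \<in> borel_measurable lborel" using hankel_integrable[OF assms(1) a, of 1] by auto
    show "?h (x n) \<in> borel_measurable lborel" for n
      using hankel_integrable[OF assms(1) a, of "x n"] x[of n] by auto
    show "AE r in lborel. (\<lambda>n. ?h (x n) r) \<longlonglongrightarrow> ?h 1 r"
    proof (rule AE_I2)
      fix r
      have "wedge \<kappa> (1 + \<kappa>) r \<noteq> 0"
        using wedge_norm_ge(1)[OF assms(1), of "1 + \<kappa>" r] assms by auto
      then show "(\<lambda>n. ?h (x n) r) \<longlonglongrightarrow> ?h 1 r"
        unfolding hankel_integrand_def powr_def by (auto intro!: tendsto_eq_intros lim_x)
    qed
    show "AE r in lborel. norm (?h (x n) r) \<le> exp (1 + \<kappa>) * exp (- \<kappa> * \<bar>r\<bar>) * (1 + \<kappa>)" for n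
      unfolding norm_mult using bd[of n] norm_wedge_deriv_le[of \<kappa>] assms
      by (intro AE_I2 mult_mono) (auto simp: wedge_bounded_def)
  qed
  also have "(\<lambda>n. LINT r|lborel. ?h (x n) r) = (\<lambda>n. 2 * of_real pi * \<i> * rGamma (of_real (x n)))"
    using hankel_integral_less_1[OF assms(1) a x] by (simp add: wedge_integral_def)
  finally have "(\<lambda>n. 2 * of_real pi * \<i> * rGamma (of_real (x n))) \<longlonglongrightarrow> wedge_integral \<kappa> (hankel_integrand 1) (1 + \<kappa>)"
    by (simp add: wedge_integral_def)
  moreover have "(\<lambda>n. 2 * of_real pi * \<i> * rGamma (complex_of_real (x n))) \<longlonglongrightarrow> 2 * of_real pi * \<i> * rGamma (of_real 1)"
    by (intro tendsto_intros isCont_tendsto_compose[of _ rGamma] isCont_rGamma lim_x) auto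
  ultimately show ?thesis
    using hankel_shift[OF assms(1,2) a, of 1] LIMSEQ_unique by fastforce
qed

text \<open>Integration by parts: the difference of the two integrands has
  \<open>hankel_integrand x\<close> as a decaying primitive.\<close>

lemma hankel_recurrence:
  assumes "\<kappa> > 0" "a > 0" "x > 0"
  shows "wedge_integral \<kappa> (hankel_integrand x) a = of_real x * wedge_integral \<kappa> (hankel_integrand (x + 1)) a"
proof -
  note int = hankel_integrable[OF assms(1,2)]
  let ?f = "\<lambda>s. hankel_integrand x s - of_real x * hankel_integrand (x + 1) s"
  have bd: "wedge_bounded \<kappa> (hankel_integrand y) a (exp a * (a / (1 + \<kappa>)) powr (- y))" if "y \<ge> 0" for y
    using hankel_integrand_bounded[OF assms(1,2) order.refl order.refl that] .
  have "wedge_integral \<kappa> ?f a = 0"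
  proof (rule wedge_integral_eq_0[OF assms(1,2)])
    show "continuous_on (wedge_region \<kappa>) ?f"
      by (intro continuous_intros holomorphic_on_imp_continuous_on hankel_integrand_holomorphic)
    show "wedge_bounded \<kappa> ?f a (exp a * (a / (1 + \<kappa>)) powr (- x) + x * (exp a * (a / (1 + \<kappa>)) powr (- (x + 1))))"
      unfolding wedge_bounded_def
    proof
      fix r
      have "norm (?f (wedge \<kappa> a r)) \<le> norm (hankel_integrand x (wedge \<kappa> a r)) + x * norm (hankel_integrand (x + 1) (wedge \<kappa> a r))"
        using norm_triangle_ineq4[of "hankel_integrand x (wedge \<kappa> a r)" "of_real x * hankel_integrand (x + 1) (wedge \<kappa> a r)"] assms
        by (simp add: norm_mult)
      also have "\<dots> \<le> exp a * (a / (1 + \<kappa>)) powr (- x) * exp (- \<kappa> * \<bar>r\<bar>) + x * (exp a * (a / (1 + \<kappa>)) powr (- (x + 1)) * exp (- \<kappa> * \<bar>r\<bar>))"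
        using bd[of x] bd[of "x + 1"] assms unfolding wedge_bounded_def by (intro add_mono mult_left_mono) auto
      finally show "norm (?f (wedge \<kappa> a r)) \<le> (exp a * (a / (1 + \<kappa>)) powr (- x) + x * (exp a * (a / (1 + \<kappa>)) powr (- (x + 1)))) * exp (- \<kappa> * \<bar>r\<bar>)"
        by (simp add: algebra_simps)
    qed
    show "wedge_bounded \<kappa> (hankel_integrand x) a (exp a * (a / (1 + \<kappa>)) powr (- x))"
      using bd assms by simp
    show "(hankel_integrand x has_field_derivative ?f s) (at s)" if "s \<in> wedge_region \<kappa>" for s
    proof -
      have e: "- complex_of_real (x + 1) = - of_real x - 1" by simp
      show ?thesis
        using DERIV_mult[OF DERIV_exp has_field_derivative_powr[OF wedge_region_nonpos_Reals[OF that], of "- of_real x"]]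
        unfolding hankel_integrand_def[abs_def] e by (simp add: mult_ac)
    qed
  qed
  moreover have "wedge_integral \<kappa> ?f a = wedge_integral \<kappa> (hankel_integrand x) a - of_real x * wedge_integral \<kappa> (hankel_integrand (x + 1)) a"
    unfolding wedge_integral_def using int[of x] int[of "x + 1"] assms
    by (simp add: left_diff_distrib mult.assoc Bochner_Integration.integral_diff)
  ultimately show ?thesis by simp
qed

text \<open>Both sides satisfy the functional equation of \<open>rGamma\<close>, which propagates
  the values from the interval from 0 to 1.\<close>

theorem hankel_integral:
  assumes "\<kappa> > 0" "a > 0" "x > 0"
  shows "wedge_integral \<kappa> (hankel_integrand x) a = 2 * of_real pi * \<i> * rGamma (of_real x)"
proof -
  have *: "wedge_integral \<kappa> (hankel_integrand (y + real n)) a = 2 * of_real pi * \<i> * rGamma (of_real (y + real n))"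
    if y: "0 < y" "y \<le> 1" for y n
  proof (induction n)
    case 0
    show ?case using hankel_integral_less_1[OF assms(1,2) y(1)] hankel_integral_1[OF assms(1,2)] y(2)
      by (cases "y = 1") auto
  next
    case (Suc n)
    let ?x = "y + real n"
    have x: "?x > 0" using y by simp
    have "of_real ?x * wedge_integral \<kappa> (hankel_integrand (?x + 1)) a = of_real ?x * (2 * of_real pi * \<i> * rGamma (of_real (?x + 1)))"
      using hankel_recurrence[OF assms(1,2) x] Suc rGamma_plus1[of "complex_of_real ?x"] by (simp add: mult_ac)
    then have "wedge_integral \<kappa> (hankel_integrand (?x + 1)) a = 2 * of_real pi * \<i> * rGamma (of_real (?x + 1))"
      using x by (metis less_irrefl mult_left_cancel of_real_eq_0_iff)
    then show ?case by (simp add: algebra_simps)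
  qed
  \<comment> \<open>The ceiling minus 1 puts the remainder \<open>x - n\<close> into the interval
    open at 0 and closed at 1.\<close>
  define n where "n = nat (\<lceil>x\<rceil> - 1)"
  have "real n = of_int \<lceil>x\<rceil> - 1" using assms by (simp add: n_def)
  then have "0 < x - real n" "x - real n \<le> 1" by linarith+
  from *[OF this, of n] show ?thesis by simp
qed

section \<open>Scalar Mittag-Leffler functions in the sector\<close>

text \<open>The Laplace-type kernel of the Mittag-Leffler function, with \<open>exp s\<close> split
  off as the source of decay and the power written with a negated exponent as in
  \<open>hankel_integrand\<close>.\<close>

definition ml_integrand :: "real \<Rightarrow> real \<Rightarrow> complex \<Rightarrow> complex \<Rightarrow> complex" where
  "ml_integrand \<alpha> \<beta> y s = exp s * (s powr (- of_real (\<beta> - \<alpha>)) / (s powr of_real \<alpha> - y))"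

lemma ml_integrand_holomorphic:
  assumes "\<And>s. s \<in> wedge_region \<kappa> \<Longrightarrow> s powr of_real \<alpha> \<noteq> y"
  shows "ml_integrand \<alpha> \<beta> y holomorphic_on wedge_region \<kappa>"
  unfolding ml_integrand_def[abs_def]
  by (intro holomorphic_intros) (use assms wedge_region_nonpos_Reals in auto)

lemma ml_integrand_bounded:
  assumes "\<kappa> > 0" "b > 0" "b \<le> c" "c \<le> a" "\<alpha> \<le> \<beta>" "\<delta> > 0"
    and \<delta>: "\<And>s. s \<in> wedge_region \<kappa> \<Longrightarrow> \<delta> \<le> norm (s powr of_real \<alpha> - y)"
  shows "wedge_bounded \<kappa> (ml_integrand \<alpha> \<beta> y) c (exp a * ((b / (1 + \<kappa>)) powr (- (\<beta> - \<alpha>)) / \<delta>))"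
  unfolding ml_integrand_def[abs_def]
proof (rule wedge_bounded_exp_mult[OF _ assms(4)])
  fix r
  have "\<delta> \<le> norm (wedge \<kappa> c r powr of_real \<alpha> - y)" using assms by (intro \<delta>) auto
  then show "norm (wedge \<kappa> c r powr (- of_real (\<beta> - \<alpha>)) / (wedge \<kappa> c r powr of_real \<alpha> - y))
      \<le> (b / (1 + \<kappa>)) powr (- (\<beta> - \<alpha>)) / \<delta>"
    unfolding norm_divide using assms
    by (intro frac_le norm_wedge_powr_le) auto
qed

lemma powr_complex_power:
  "(s powr a) ^ n = s powr (a * of_nat n)" if "s \<noteq> 0" for s a :: complex
  using that by (simp add: powr_def exp_of_nat_mult[symmetric] mult_ac)

text \<open>A geometric sum with ratio \<open>y / s powr \<alpha>\<close>; its remainder after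
  \<open>n\<close> terms is the whole sum times the \<open>n\<close>-th power of the ratio.\<close>

lemma ml_partial_sum:
  assumes "s \<noteq> 0" "s powr of_real \<alpha> \<noteq> y"
  shows "ml_integrand \<alpha> \<beta> y s - (\<Sum>k<n. y ^ k * hankel_integrand (\<alpha> * real k + \<beta>) s)
       = ml_integrand \<alpha> \<beta> y s * (y / s powr of_real \<alpha>) ^ n"
proof -
  define p where "p = s powr of_real \<alpha>"
  have p: "p \<noteq> 0" "p \<noteq> y" using assms by (simp_all add: p_def)
  have h: "y ^ k * hankel_integrand (\<alpha> * real k + \<beta>) s = exp s * s powr (- of_real \<beta>) * (y / p) ^ k" for k
  proof -
    have "s powr (- of_real (\<alpha> * real k + \<beta>)) = s powr (- of_real \<beta>) / p ^ k"
      unfolding p_def using assms(1) by (simp add: powr_complex_power powr_diff powr_minus divide_inverse mult.commute)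
    then show ?thesis by (simp add: hankel_integrand_def power_divide)
  qed
  have "s powr (- of_real (\<beta> - \<alpha>)) = s powr (- of_real \<beta>) * p"
    unfolding p_def by (simp flip: powr_add)
  then have ml: "ml_integrand \<alpha> \<beta> y s = exp s * s powr (- of_real \<beta>) * (1 / (1 - y / p))"
    using p by (simp add: ml_integrand_def p_def[symmetric] field_simps)
  define q where "q = y / p"
  have "q \<noteq> 1" using p by (simp add: q_def)
  then have "(\<Sum>k<n. q ^ k) = (1 - q ^ n) / (1 - q)"
    using geometric_sum[of q n] minus_divide_divide[of "1 - q ^ n" "1 - q"] by simp
  then show ?thesis
    unfolding h sum_distrib_left[symmetric] ml p_def[symmetric] q_def[symmetric]
    by (simp add: diff_divide_distrib right_diff_distrib)
qed

text \<open>The bound by \<open>\<delta>\<close> keeps the poles out of the region, so the vertex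
  may be moved to a large \<open>b\<close>. There the ratio of the geometric series is at most 1/2,
  Hankel's integral evaluates each term, and the integral of the remainder tends to 0.\<close>

theorem ml_integral:
  assumes "\<kappa> > 0" "a > 0" "0 < \<alpha>" "\<alpha> \<le> \<beta>" "\<delta> > 0"
    and \<delta>: "\<And>s. s \<in> wedge_region \<kappa> \<Longrightarrow> \<delta> \<le> norm (s powr of_real \<alpha> - y)"
  shows "(\<lambda>k. rGamma (of_real (\<alpha> * real k + \<beta>)) * y ^ k) sums
           (wedge_integral \<kappa> (ml_integrand \<alpha> \<beta> y) a / (2 * of_real pi * \<i>))"
proof -
  let ?f = "ml_integrand \<alpha> \<beta> y"
  have ne: "s powr of_real \<alpha> \<noteq> y" if "s \<in> wedge_region \<kappa>" for s using \<delta>[OF that] assms(5) by auto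
  note hol = ml_integrand_holomorphic[OF ne, of \<kappa> \<beta>]
  note bd = ml_integrand_bounded[OF assms(1) _ _ _ assms(4,5) \<delta>]
  \<comment> \<open>On the wedge with vertex \<open>b\<close> the modulus is at least
    \<open>Q\<close>, hence \<open>s powr \<alpha>\<close> has modulus at least
    \<open>2 * norm y + 1\<close>. The summand 1 keeps \<open>Q\<close> positive when
    \<open>y = 0\<close>.\<close>
  define Q where "Q = (2 * norm y + 1) powr (1 / \<alpha>)"
  define b where "b = (1 + \<kappa>) * Q"
  have "2 * norm y + 1 \<noteq> 0" using norm_ge_zero[of y] by linarith
  then have Q: "Q > 0" by (simp add: Q_def)
  then have b: "b > 0" using assms(1) by (simp add: b_def)
  have "wedge_integral \<kappa> ?f a = wedge_integral \<kappa> ?f b"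
    using wedge_integral_shift[OF assms(1,2) _ hol bd[OF assms(2)]] wedge_integral_shift[OF assms(1) b _ hol bd[OF b]]
    by (metis linear)
  define B where "B = exp b * ((b / (1 + \<kappa>)) powr (- (\<beta> - \<alpha>)) / \<delta>)"
  have B: "wedge_bounded \<kappa> ?f b B" using bd[OF b order.refl order.refl] by (simp add: B_def)
  define D where "D = (\<lambda>n s. ?f s - (\<Sum>k<n. y ^ k * hankel_integrand (\<alpha> * real k + \<beta>) s))"
  have D_bound: "wedge_bounded \<kappa> (D n) b (B * (1/2) ^ n)" for n
    unfolding wedge_bounded_def
  proof
    fix r
    let ?s = "wedge \<kappa> b r"
    have s: "?s \<in> wedge_region \<kappa>" using b by simp
    then have s0: "?s \<noteq> 0" using wedge_region_nonpos_Reals by fastforce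
    have "Q \<le> norm ?s" using wedge_norm_ge(1)[OF assms(1), of b r] assms(1) by (simp add: b_def)
    then have "Q powr \<alpha> \<le> norm ?s powr \<alpha>" using Q assms(3) by (intro powr_mono2) auto
    moreover have "Q powr \<alpha> = 2 * norm y + 1" using assms(3) by (simp add: Q_def powr_powr)
    moreover have "norm (?s powr of_real \<alpha>) = norm ?s powr \<alpha>" by (subst norm_powr_real_powr') auto
    ultimately have "2 * norm y + 1 \<le> norm (?s powr of_real \<alpha>)" by linarith
    then have "norm (y / ?s powr of_real \<alpha>) \<le> 1/2"
      by (simp add: norm_divide divide_le_eq)
    then have "norm ((y / ?s powr of_real \<alpha>) ^ n) \<le> (1/2) ^ n"
      unfolding norm_power by (intro power_mono) auto
    moreover have "norm (?f ?s) \<le> B * exp (- \<kappa> * \<bar>r\<bar>)" using B by (simp add: wedge_bounded_def)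
    ultimately have "norm (?f ?s * (y / ?s powr of_real \<alpha>) ^ n) \<le> (B * exp (- \<kappa> * \<bar>r\<bar>)) * (1/2) ^ n"
      unfolding norm_mult by (intro mult_mono') auto
    then show "norm (D n ?s) \<le> B * (1/2) ^ n * exp (- \<kappa> * \<bar>r\<bar>)"
      unfolding D_def ml_partial_sum[OF s0 ne[OF s]] by (simp add: mult_ac)
  qed
  have cont: "continuous_on (wedge_region \<kappa>) ?f" by (rule holomorphic_on_imp_continuous_on[OF hol])
  have contD: "continuous_on (wedge_region \<kappa>) (D n)" for n
    unfolding D_def
    by (intro continuous_intros cont holomorphic_on_imp_continuous_on[OF hankel_integrand_holomorphic])
  have D: "wedge_integral \<kappa> (D n) b = wedge_integral \<kappa> ?f b
      - (2 * of_real pi * \<i>) * (\<Sum>k<n. rGamma (of_real (\<alpha> * real k + \<beta>)) * y ^ k)" for n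
  proof -
    have pos: "\<alpha> * real k + \<beta> > 0" for k using assms by (simp add: add_nonneg_pos)
    have int: "integrable lborel (\<lambda>r. y ^ k * (hankel_integrand (\<alpha> * real k + \<beta>) (wedge \<kappa> b r) * wedge_deriv \<kappa> r))" for k
      using hankel_integrable[OF assms(1) b, of "\<alpha> * real k + \<beta>"] pos[of k] by auto
    have "wedge_integral \<kappa> (D n) b = (LINT r|lborel. ?f (wedge \<kappa> b r) * wedge_deriv \<kappa> r
       - (\<Sum>k<n. y ^ k * (hankel_integrand (\<alpha> * real k + \<beta>) (wedge \<kappa> b r) * wedge_deriv \<kappa> r)))"
      by (simp add: wedge_integral_def D_def left_diff_distrib sum_distrib_right mult.assoc)
    also have "\<dots> = wedge_integral \<kappa> ?f b - (\<Sum>k<n. y ^ k * wedge_integral \<kappa> (hankel_integrand (\<alpha> * real k + \<beta>)) b)"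
      using wedge_integrable(1)[OF assms(1) b cont B] int
      by (subst Bochner_Integration.integral_diff)
        (auto simp: wedge_integral_def Bochner_Integration.integral_sum)
    also have "(\<Sum>k<n. y ^ k * wedge_integral \<kappa> (hankel_integrand (\<alpha> * real k + \<beta>)) b)
      = (2 * of_real pi * \<i>) * (\<Sum>k<n. rGamma (of_real (\<alpha> * real k + \<beta>)) * y ^ k)"
      unfolding sum_distrib_left by (intro sum.cong refl) (simp add: hankel_integral[OF assms(1) b pos] mult_ac)
    finally show ?thesis .
  qed
  have "(\<lambda>n. wedge_integral \<kappa> (D n) b) \<longlonglongrightarrow> 0"
  proof (rule Lim_null_comparison[OF always_eventually])
    show "\<forall>n. norm (wedge_integral \<kappa> (D n) b) \<le> B * (1/2) ^ n * ((1 + \<kappa>) * (LINT r|lborel. exp (- \<kappa> * \<bar>r\<bar>)))"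
      using wedge_integrable(2)[OF assms(1) b contD D_bound] by blast
    show "(\<lambda>n. B * (1/2) ^ n * ((1 + \<kappa>) * (LINT r|lborel. exp (- \<kappa> * \<bar>r\<bar>)))) \<longlonglongrightarrow> 0"
      by (intro tendsto_mult_left_zero tendsto_mult_right_zero LIMSEQ_power_zero) auto
  qed
  then have "(\<lambda>n. (wedge_integral \<kappa> ?f b - wedge_integral \<kappa> (D n) b) / (2 * of_real pi * \<i>))
      \<longlonglongrightarrow> (wedge_integral \<kappa> ?f b - 0) / (2 * of_real pi * \<i>)"
    by (intro tendsto_intros) auto
  then show ?thesis
    using \<open>wedge_integral \<kappa> ?f a = wedge_integral \<kappa> ?f b\<close> by (simp add: sums_def D)
qed

text \<open>By compactness, \<open>K\<close> still satisfies the sector inequality for an angle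
  \<open>\<theta>\<close> slightly above \<open>pi / 2\<close>. The power \<open>\<alpha>\<close>
  maps the sector of half-angle \<open>\<theta>\<close> into the closed cone \<open>S\<close> of
  half-angle \<open>\<alpha> * \<theta>\<close>, which has positive distance from \<open>K\<close>.
  As \<open>S\<close> is a cone, scaling by \<open>t\<close> multiplies the distance by
  \<open>t\<close>.\<close>

lemma sector_separation:
  assumes "0 < \<alpha>" "\<alpha> < 1" "compact K" and K: "K \<subseteq> {z. Re z < norm z * cos (\<alpha> * pi / 2)}"
  obtains \<kappa> \<delta> where "\<kappa> > 0" "\<delta> > 0" "\<And>z. z \<in> K \<Longrightarrow> \<delta> \<le> norm z"
    "\<And>s z t. s \<in> wedge_region \<kappa> \<Longrightarrow> z \<in> K \<Longrightarrow> t > 0 \<Longrightarrow> \<delta> * t \<le> norm (s powr of_real \<alpha> - of_real t * z)"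
proof -
  have "\<exists>\<theta>. pi / 2 < \<theta> \<and> \<theta> < pi \<and> (\<forall>z\<in>K. Re z < norm z * cos (\<alpha> * \<theta>))"
  proof (cases "K = {}")
    case True
    then show ?thesis using pi_gt_zero by (intro exI[of _ "3 * pi / 4"]) auto
  next
    case False
    have "continuous_on K (\<lambda>z. norm z * cos (\<alpha> * pi / 2) - Re z)" by (intro continuous_intros)
    from continuous_attains_inf[OF assms(3) False this] obtain z0 where z0: "z0 \<in> K"
      "\<And>z. z \<in> K \<Longrightarrow> norm z0 * cos (\<alpha> * pi / 2) - Re z0 \<le> norm z * cos (\<alpha> * pi / 2) - Re z" by blast
    \<comment> \<open>\<open>m\<close> is the least gap in the inequality over \<open>K\<close>. If
      the cosine drops by less than \<open>m / R\<close>, the inequality stays strict because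
      \<open>norm z \<le> R\<close>.\<close>
    define m where "m = norm z0 * cos (\<alpha> * pi / 2) - Re z0"
    have m: "m > 0" using z0(1) K by (auto simp: m_def)
    obtain R where R: "R > 0" "\<And>z. z \<in> K \<Longrightarrow> norm z \<le> R"
      using compact_imp_bounded[OF assms(3)] by (auto simp: bounded_pos)
    have "((\<lambda>\<theta>. cos (\<alpha> * \<theta>)) \<longlongrightarrow> cos (\<alpha> * (pi / 2))) (at_right (pi / 2))"
      by (intro tendsto_intros)
    then have "\<forall>\<^sub>F \<theta> in at_right (pi / 2). cos (\<alpha> * (pi / 2)) - m / R < cos (\<alpha> * \<theta>)"
      by (rule order_tendstoD) (use m R in simp)
    moreover have "\<forall>\<^sub>F \<theta> in at_right (pi / 2). \<theta> \<in> {pi / 2<..<pi}"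
      by (rule eventually_at_right_real) simp
    ultimately have "\<forall>\<^sub>F \<theta> in at_right (pi / 2). cos (\<alpha> * (pi / 2)) - m / R < cos (\<alpha> * \<theta>) \<and> \<theta> \<in> {pi / 2<..<pi}"
      by (rule eventually_conj)
    then obtain \<theta> where \<theta>: "cos (\<alpha> * (pi / 2)) - m / R < cos (\<alpha> * \<theta>)" "pi / 2 < \<theta>" "\<theta> < pi"
      using eventually_happens'[OF trivial_limit_at_right_real] by auto
    have "Re z < norm z * cos (\<alpha> * \<theta>)" if z: "z \<in> K" for z
    proof -
      have "z \<noteq> 0" using z K by auto
      then have "norm z * (cos (\<alpha> * (pi / 2)) - m / R) < norm z * cos (\<alpha> * \<theta>)"
        using \<theta>(1) by simp
      moreover have "norm z * (m / R) \<le> R * (m / R)" using R(1) R(2)[OF z] m by (intro mult_right_mono) auto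
      moreover have "R * (m / R) = m" using R(1) by simp
      moreover have "m \<le> norm z * cos (\<alpha> * (pi / 2)) - Re z" using z0(2)[OF z] by (simp add: m_def)
      ultimately show ?thesis unfolding right_diff_distrib by linarith
    qed
    with \<theta> show ?thesis by blast
  qed
  then obtain \<theta> where \<theta>: "pi / 2 < \<theta>" "\<theta> < pi" "\<And>z. z \<in> K \<Longrightarrow> Re z < norm z * cos (\<alpha> * \<theta>)" by blast
  define S where "S = {w. norm w * cos (\<alpha> * \<theta>) \<le> Re w}"
  have "closed S" unfolding S_def by (intro closed_Collect_le continuous_intros)
  moreover have "K \<inter> S = {}" using \<theta>(3) by (force simp: S_def)
  ultimately obtain \<delta> where \<delta>: "\<delta> > 0" "\<And>z w. z \<in> K \<Longrightarrow> w \<in> S \<Longrightarrow> \<delta> \<le> dist z w"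
    using separate_compact_closed[OF assms(3), of S] by blast
  \<comment> \<open>With this slope \<open>wedge_region \<kappa>\<close> is exactly the sector of
    nonzero \<open>s\<close> with \<open>\<bar>Arg s\<bar> < \<theta>\<close>; multiplying its
    inequality by \<open>sin \<theta>\<close> gives
    \<open>sin (\<theta> - \<bar>Arg s\<bar>) > 0\<close>.\<close>
  define \<kappa> where "\<kappa> = - cos \<theta> / sin \<theta>"
  have sin: "sin \<theta> > 0" using \<theta> by (intro sin_gt_zero) auto
  have "cos \<theta> < cos (pi / 2)" using \<theta> by (intro cos_monotone_0_pi) auto
  then have \<kappa>: "\<kappa> > 0" using sin by (simp add: \<kappa>_def divide_neg_pos)
  have powr_S: "s powr of_real \<alpha> \<in> S" if s: "s \<in> wedge_region \<kappa>" for s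
  proof -
    define \<phi> where "\<phi> = Arg s"
    have s0: "s \<noteq> 0" using s by (auto simp: wedge_region_def)
    have \<phi>: "\<bar>\<phi>\<bar> \<le> pi" using Arg_bounded[of s] unfolding \<phi>_def by linarith
    have Re_Im: "Re s = norm s * cos \<phi>" "Im s = norm s * sin \<phi>"
      using rcis_cmod_Arg[of s] Re_rcis[of "norm s" \<phi>] Im_rcis[of "norm s" \<phi>] by (simp_all add: \<phi>_def)
    have "\<bar>sin \<phi>\<bar> = sin \<bar>\<phi>\<bar>" using \<phi> sin_ge_zero[of "\<bar>\<phi>\<bar>"] by (cases "\<phi> \<ge> 0") auto
    then have "0 < norm s * (cos \<bar>\<phi>\<bar> + \<kappa> * sin \<bar>\<phi>\<bar>)"
      using s by (simp add: wedge_region_def Re_Im abs_mult algebra_simps)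
    then have "0 < cos \<bar>\<phi>\<bar> + \<kappa> * sin \<bar>\<phi>\<bar>" using s0 by (simp add: zero_less_mult_iff)
    then have "0 < sin \<theta> * (cos \<bar>\<phi>\<bar> + \<kappa> * sin \<bar>\<phi>\<bar>)" using sin by simp
    also have "\<dots> = sin (\<theta> - \<bar>\<phi>\<bar>)" using sin by (simp add: sin_diff \<kappa>_def field_simps)
    finally have "\<bar>\<phi>\<bar> < \<theta>"
      using sin_ge_zero[of "\<bar>\<phi>\<bar> - \<theta>"] \<phi> \<theta> sin_minus[of "\<theta> - \<bar>\<phi>\<bar>"] by fastforce
    then have "cos (\<alpha> * \<theta>) \<le> cos (\<alpha> * \<bar>\<phi>\<bar>)"
    proof (intro cos_monotone_0_pi_le)
      have "\<alpha> * \<theta> \<le> 1 * \<theta>" using assms(2) \<theta>(1) pi_gt_zero by (intro mult_right_mono) linarith+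
      then show "\<alpha> * \<theta> \<le> pi" using \<theta>(2) by simp
    qed (use assms(1) in auto)
    also have "\<dots> = cos (\<alpha> * \<phi>)" by (cases "\<phi> \<ge> 0") auto
    finally have c: "cos (\<alpha> * \<theta>) \<le> cos (\<alpha> * \<phi>)" .
    have Ln: "Ln s = of_real (ln (norm s)) + \<i> * of_real \<phi>"
      using s0 by (simp add: complex_eq_iff \<phi>_def Arg_eq_Im_Ln)
    have "Re (s powr of_real \<alpha>) = norm s powr \<alpha> * cos (\<alpha> * \<phi>)"
      using s0 by (simp add: powr_def Ln Re_exp)
    moreover have "norm (s powr of_real \<alpha>) = norm s powr \<alpha>" by (subst norm_powr_real_powr') auto
    ultimately show ?thesis using c by (simp add: S_def mult_left_mono)
  qed
  show ?thesis
  proof (rule that[OF \<kappa> \<delta>(1)])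
    \<comment> \<open>The apex 0 belongs to \<open>S\<close>.\<close>
    show "\<delta> \<le> norm z" if "z \<in> K" for z using \<delta>(2)[OF that, of 0] by (simp add: S_def)
    fix s z and t :: real assume s: "s \<in> wedge_region \<kappa>" and z: "z \<in> K" and t: "t > 0"
    let ?w = "s powr of_real \<alpha>"
    have "?w / of_real t \<in> S"
      using powr_S[OF s] t by (simp add: S_def norm_divide divide_right_mono)
    then have "t * \<delta> \<le> norm (complex_of_real t) * norm (z - ?w / of_real t)"
      using \<delta>(2)[OF z] t by (simp add: dist_norm)
    also have "\<dots> = norm (of_real t * z - ?w)"
      unfolding norm_mult[symmetric] using t by (simp add: right_diff_distrib)
    finally show "\<delta> * t \<le> norm (?w - of_real t * z)" by (simp add: norm_minus_commute mult.commute)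
  qed
qed

text \<open>The integral representation contains convergence of the power series. It applies at
  \<open>- T\<close> with \<open>T > R\<close>, because the negative axis lies in the sector, and
  inside that radius convergence is absolute.\<close>

lemma ml_norm_summable:
  assumes "0 < \<alpha>" "\<alpha> < 1" "\<alpha> \<le> \<beta>" "R \<ge> 0"
  shows "summable (\<lambda>k. norm (rGamma (complex_of_real (\<alpha> * real k + \<beta>))) * R ^ k)"
proof -
  have "0 < cos (\<alpha> * pi / 2)"
    using assms by (intro cos_gt_zero) auto
  then have K: "{-1} \<subseteq> {z. Re z < norm z * cos (\<alpha> * pi / 2)}" by simp
  obtain \<kappa> \<delta> where *: "\<kappa> > 0" "\<delta> > 0"
    "\<And>s z t. s \<in> wedge_region \<kappa> \<Longrightarrow> z \<in> {-1} \<Longrightarrow> t > 0 \<Longrightarrow> \<delta> * t \<le> norm (s powr of_real \<alpha> - of_real t * z)"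
    by (rule sector_separation[OF assms(1,2) _ K]) auto
  define T where "T = \<bar>R\<bar> + 1"
  have T: "T > 0" by (simp add: T_def)
  have "summable (\<lambda>k. rGamma (of_real (\<alpha> * real k + \<beta>)) * (complex_of_real T * (-1)) ^ k)"
    using ml_integral[OF *(1) zero_less_one assms(1,3), of "\<delta> * T" "of_real T * (-1)"] *(2) *(3)[of _ "-1" T] T
    by (auto intro: sums_summable)
  moreover have "norm (complex_of_real R) < norm (complex_of_real T * (-1))"
    using T by simp (simp add: T_def)
  ultimately have "summable (\<lambda>k. norm (rGamma (of_real (\<alpha> * real k + \<beta>)) * complex_of_real R ^ k))"
    by (rule powser_insidea)
  then show ?thesis using assms(4) by (simp add: norm_mult norm_power)
qed

text \<open>At the fixed vertex 1 the denominator is at least \<open>\<delta> * t\<close>, and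
  nothing else in the majorant depends on \<open>t\<close>.\<close>

lemma ml_1_decay:
  assumes "0 < \<alpha>" "\<alpha> < 1" "compact K" and K: "K \<subseteq> {z. Re z < norm z * cos (\<alpha> * pi / 2)}"
  obtains C where "C \<ge> 0" "\<And>z t. z \<in> K \<Longrightarrow> t > 0 \<Longrightarrow>
    norm (\<Sum>k. rGamma (of_real (\<alpha> * real k + 1)) * (of_real t * z) ^ k) \<le> C / t"
proof -
  obtain \<kappa> \<delta> where *: "\<kappa> > 0" "\<delta> > 0" "\<And>z. z \<in> K \<Longrightarrow> \<delta> \<le> norm z"
    "\<And>s z t. s \<in> wedge_region \<kappa> \<Longrightarrow> z \<in> K \<Longrightarrow> t > 0 \<Longrightarrow> \<delta> * t \<le> norm (s powr of_real \<alpha> - of_real t * z)"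
    by (rule sector_separation[OF assms]) blast
  define J where "J = (1 + \<kappa>) * (LINT r|lborel. exp (- \<kappa> * \<bar>r\<bar>))"
  define C where "C = exp 1 * ((1 / (1 + \<kappa>)) powr (- (1 - \<alpha>)) / \<delta>) * J / (2 * pi)"
  have "J \<ge> 0" using *(1) by (simp add: J_def integral_nonneg_AE)
  then have "C \<ge> 0" using *(2) by (simp add: C_def)
  moreover have "norm (\<Sum>k. rGamma (of_real (\<alpha> * real k + 1)) * (of_real t * z) ^ k) \<le> C / t"
    if z: "z \<in> K" and t: "t > 0" for z t
  proof -
    let ?f = "ml_integrand \<alpha> 1 (of_real t * z)"
    have n2: "norm (2 * complex_of_real pi * \<i>) = 2 * pi" by (simp add: norm_mult)
    have d: "\<delta> * t > 0" using *(2) t by simp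
    note \<delta> = *(4)[OF _ z t]
    have hol: "?f holomorphic_on wedge_region \<kappa>" by (rule ml_integrand_holomorphic) (use \<delta> d in fastforce)
    have "norm (wedge_integral \<kappa> ?f 1) \<le> exp 1 * ((1 / (1 + \<kappa>)) powr (- (1 - \<alpha>)) / (\<delta> * t)) * J"
      unfolding J_def using assms(2)
      by (intro wedge_integrable(2) ml_integrand_bounded * d \<delta> holomorphic_on_imp_continuous_on hol) auto
    then have "norm (wedge_integral \<kappa> ?f 1 / (2 * of_real pi * \<i>)) \<le> exp 1 * ((1 / (1 + \<kappa>)) powr (- (1 - \<alpha>)) / (\<delta> * t)) * J / (2 * pi)"
      unfolding norm_divide n2 by (rule divide_right_mono) simp
    also have "\<dots> = C / t" by (simp add: C_def)
    finally show ?thesis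
      using sums_unique[OF ml_integral[OF *(1) zero_less_one assms(1) _ d \<delta>, of 1]] assms(2) by simp
  qed
  ultimately show ?thesis by (rule that)
qed

text \<open>For the majorant of the sharper decay estimate. The power grows at most linearly and is
  absorbed by half of the exponential rate.\<close>

lemma integrable_exp_minus_abs_powr:
  assumes "\<kappa> > 0" "\<alpha> \<ge> 0" "\<alpha> \<le> 1"
  shows "integrable lborel (\<lambda>r. exp (- \<kappa> * \<bar>r\<bar>) * norm (wedge \<kappa> 1 r) powr \<alpha>)"
proof -
  \<comment> \<open>The two entries make \<open>M * (1 + \<kappa> / 2 * \<bar>r\<bar>)\<close>
    dominate \<open>2 + (1 + \<kappa>) * \<bar>r\<bar>\<close>, in the constant and in the
    slope.\<close>
  define M where "M = max 2 (2 * (1 + \<kappa>) / \<kappa>)"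
  have M: "2 \<le> M" "2 * (1 + \<kappa>) / \<kappa> \<le> M" unfolding M_def by (rule max.cobounded1, rule max.cobounded2)
  have le: "norm (exp (- \<kappa> * \<bar>r\<bar>) * norm (wedge \<kappa> 1 r) powr \<alpha>) \<le> norm (M * exp (- (\<kappa> / 2) * \<bar>r\<bar>))" for r
  proof -
    have w: "norm (wedge \<kappa> 1 r) \<le> 1 + (1 + \<kappa>) * \<bar>r\<bar>"
    proof -
      have "0 \<le> \<kappa> * \<bar>r\<bar>" using assms(1) by simp
      then have "\<bar>1 - \<kappa> * \<bar>r\<bar>\<bar> \<le> 1 + \<kappa> * \<bar>r\<bar>" by linarith
      moreover have "norm (wedge \<kappa> 1 r) \<le> \<bar>1 - \<kappa> * \<bar>r\<bar>\<bar> + \<bar>r\<bar>"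
        using cmod_le[of "wedge \<kappa> 1 r"] by simp
      ultimately show ?thesis unfolding distrib_right by linarith
    qed
    have "norm (wedge \<kappa> 1 r) powr \<alpha> \<le> (1 + norm (wedge \<kappa> 1 r)) powr \<alpha>"
      using assms by (intro powr_mono2) auto
    also have "\<dots> \<le> (1 + norm (wedge \<kappa> 1 r)) powr 1" using assms by (intro powr_mono) auto
    also have "\<dots> \<le> 2 + (1 + \<kappa>) * \<bar>r\<bar>" using w by simp
    also have "\<dots> \<le> M * (1 + \<kappa> / 2 * \<bar>r\<bar>)"
    proof -
      have "2 * (1 + \<kappa>) / \<kappa> * (\<kappa> / 2 * \<bar>r\<bar>) \<le> M * (\<kappa> / 2 * \<bar>r\<bar>)"
        using assms(1) M(2) by (intro mult_right_mono) auto
      moreover have "2 * (1 + \<kappa>) / \<kappa> * (\<kappa> / 2 * \<bar>r\<bar>) = (1 + \<kappa>) * \<bar>r\<bar>" using assms by simp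
      ultimately show ?thesis using M(1) unfolding distrib_left by linarith
    qed
    also have "\<dots> \<le> M * exp (\<kappa> / 2 * \<bar>r\<bar>)"
      using exp_ge_add_one_self[of "\<kappa> / 2 * \<bar>r\<bar>"] M(1) by (intro mult_left_mono) linarith+
    finally have "exp (- \<kappa> * \<bar>r\<bar>) * norm (wedge \<kappa> 1 r) powr \<alpha> \<le> exp (- \<kappa> * \<bar>r\<bar>) * (M * exp (\<kappa> / 2 * \<bar>r\<bar>))"
      by (intro mult_left_mono) auto
    also have "\<dots> = M * (exp (- \<kappa> * \<bar>r\<bar>) * exp (\<kappa> / 2 * \<bar>r\<bar>))" by (simp only: mult_ac)
    also have "exp (- \<kappa> * \<bar>r\<bar>) * exp (\<kappa> / 2 * \<bar>r\<bar>) = exp (- (\<kappa> / 2) * \<bar>r\<bar>)"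
      unfolding exp_add[symmetric] by (simp add: field_simps)
    finally show ?thesis using M(1) by (simp add: abs_mult)
  qed
  have int: "integrable lborel (\<lambda>r. M * exp (- (\<kappa> / 2) * \<bar>r\<bar>))"
    using integrable_exp_minus_abs[of "\<kappa> / 2"] assms by simp
  have meas: "(\<lambda>r. exp (- \<kappa> * \<bar>r\<bar>) * norm (wedge \<kappa> 1 r) powr \<alpha>) \<in> borel_measurable lborel"
  proof -
    have [measurable]: "wedge \<kappa> 1 \<in> borel_measurable borel"
      by (intro borel_measurable_continuous_onI continuous_wedge)
    show ?thesis by measurable
  qed
  show ?thesis by (rule Bochner_Integration.integrable_bound[OF int meas AE_I2[OF le]])
qed

lemma wedge_integral_exp:
  assumes "\<kappa> > 0"
  shows "wedge_integral \<kappa> exp 1 = 0" and "integrable lborel (\<lambda>r. exp (wedge \<kappa> 1 r) * wedge_deriv \<kappa> r)"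
proof -
  have b: "wedge_bounded \<kappa> exp 1 (exp 1 * 1)"
    using wedge_bounded_exp_mult[of "\<lambda>_. 1" \<kappa> 1 1 1] by simp
  show "wedge_integral \<kappa> exp 1 = 0"
    by (rule wedge_integral_eq_0[OF assms _ _ b DERIV_exp b]) (auto intro: continuous_intros)
  show "integrable lborel (\<lambda>r. exp (wedge \<kappa> 1 r) * wedge_deriv \<kappa> r)"
    by (rule wedge_integrable(1)[OF assms _ _ b]) (auto intro: continuous_intros)
qed

text \<open>For \<open>\<beta> = \<alpha>\<close> the leading term \<open>- e\<^sup>s / y\<close> of the integrand is entire and integrates to zero,
  which improves the decay by one order.\<close>

lemma ml_alpha_decay:
  assumes "0 < \<alpha>" "\<alpha> < 1" "compact K" and K: "K \<subseteq> {z. Re z < norm z * cos (\<alpha> * pi / 2)}"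
  obtains C where "C \<ge> 0" "\<And>z t. z \<in> K \<Longrightarrow> t > 0 \<Longrightarrow>
    norm (\<Sum>k. rGamma (of_real (\<alpha> * real k + \<alpha>)) * (of_real t * z) ^ k) \<le> C / t\<^sup>2"
proof -
  obtain \<kappa> \<delta> where *: "\<kappa> > 0" "\<delta> > 0" "\<And>z. z \<in> K \<Longrightarrow> \<delta> \<le> norm z"
    "\<And>s z t. s \<in> wedge_region \<kappa> \<Longrightarrow> z \<in> K \<Longrightarrow> t > 0 \<Longrightarrow> \<delta> * t \<le> norm (s powr of_real \<alpha> - of_real t * z)"
    by (rule sector_separation[OF assms]) blast
  define J where "J = (LINT r|lborel. exp (- \<kappa> * \<bar>r\<bar>) * norm (wedge \<kappa> 1 r) powr \<alpha>)"
  define C where "C = exp 1 * (1 + \<kappa>) / \<delta>\<^sup>2 * J / (2 * pi)"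
  have "J \<ge> 0" by (simp add: J_def integral_nonneg_AE)
  then have "C \<ge> 0" using *(1) by (simp add: C_def)
  moreover have "norm (\<Sum>k. rGamma (of_real (\<alpha> * real k + \<alpha>)) * (of_real t * z) ^ k) \<le> C / t\<^sup>2"
    if z: "z \<in> K" and t: "t > 0" for z t
  proof -
    define y where "y = of_real t * z"
    let ?f = "ml_integrand \<alpha> \<alpha> y"
    have n2: "norm (2 * complex_of_real pi * \<i>) = 2 * pi" by (simp add: norm_mult)
    have d: "\<delta> * t > 0" using *(2) t by simp
    have \<delta>: "\<delta> * t \<le> norm (s powr of_real \<alpha> - y)" if "s \<in> wedge_region \<kappa>" for s
      using *(4)[OF that z t] by (simp add: y_def)
    have y: "\<delta> * t \<le> norm y" using *(3)[OF z] t by (simp add: y_def norm_mult mult.commute)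
    then have "y \<noteq> 0" using d by auto
    have hol: "?f holomorphic_on wedge_region \<kappa>" by (rule ml_integrand_holomorphic) (use \<delta> d in fastforce)
    have int_f: "integrable lborel (\<lambda>r. ?f (wedge \<kappa> 1 r) * wedge_deriv \<kappa> r)"
      by (rule wedge_integrable(1)[OF *(1) _ holomorphic_on_imp_continuous_on[OF hol]
            ml_integrand_bounded[OF *(1) zero_less_one order.refl order.refl order.refl d \<delta>]]) auto
    note int_exp = wedge_integral_exp(2)[OF *(1)]
    \<comment> \<open>With \<open>p = s powr \<alpha>\<close>, the sum
      \<open>1 / (p - y) + 1 / y\<close> equals \<open>p / (y * (p - y))\<close>, whose denominator
      is of order \<open>t\<^sup>2\<close>. Knowing \<open>s \<noteq> 0\<close> matters because
      \<open>s powr 0\<close> is 1 only then.\<close>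
    have eq: "?f s + exp s / y = exp s * (s powr of_real \<alpha> / (y * (s powr of_real \<alpha> - y)))"
      if "s \<in> wedge_region \<kappa>" for s
    proof -
      have "s \<noteq> 0" using wedge_region_nonpos_Reals[OF that] by auto
      moreover have "s powr of_real \<alpha> - y \<noteq> 0" using \<delta>[OF that] d by auto
      moreover have "e * (1 / (p - y)) + e / y = e * (p / (y * (p - y)))" if "p - y \<noteq> 0" for e p
        using that \<open>y \<noteq> 0\<close> by (simp add: field_simps)
      ultimately show ?thesis by (simp add: ml_integrand_def)
    qed
    have "wedge_integral \<kappa> ?f 1 = wedge_integral \<kappa> ?f 1 + wedge_integral \<kappa> exp 1 / y"
      by (simp add: wedge_integral_exp(1)[OF *(1)])
    also have "\<dots> = (LINT r|lborel. ?f (wedge \<kappa> 1 r) * wedge_deriv \<kappa> r + exp (wedge \<kappa> 1 r) * wedge_deriv \<kappa> r / y)"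
      unfolding wedge_integral_def using int_f int_exp by (simp add: Bochner_Integration.integral_add)
    finally have split: "wedge_integral \<kappa> ?f 1 = (LINT r|lborel. ?f (wedge \<kappa> 1 r) * wedge_deriv \<kappa> r + exp (wedge \<kappa> 1 r) * wedge_deriv \<kappa> r / y)" .
    have "norm (wedge_integral \<kappa> ?f 1) \<le> (LINT r|lborel. exp 1 * (1 + \<kappa>) / (\<delta> * t)\<^sup>2 * (exp (- \<kappa> * \<bar>r\<bar>) * norm (wedge \<kappa> 1 r) powr \<alpha>))"
      unfolding split
    proof (rule Bochner_Integration.integral_norm_bound_integral)
      show "integrable lborel (\<lambda>r. ?f (wedge \<kappa> 1 r) * wedge_deriv \<kappa> r + exp (wedge \<kappa> 1 r) * wedge_deriv \<kappa> r / y)"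
        using int_f int_exp by simp
      show "integrable lborel (\<lambda>r. exp 1 * (1 + \<kappa>) / (\<delta> * t)\<^sup>2 * (exp (- \<kappa> * \<bar>r\<bar>) * norm (wedge \<kappa> 1 r) powr \<alpha>))"
        by (intro integrable_mult_right integrable_exp_minus_abs_powr) (use *(1) assms(1,2) in simp_all)
      fix r
      let ?s = "wedge \<kappa> 1 r"
      have s: "?s \<in> wedge_region \<kappa>" by simp
      have "?f ?s * wedge_deriv \<kappa> r + exp ?s * wedge_deriv \<kappa> r / y
          = exp ?s * (?s powr of_real \<alpha> / (y * (?s powr of_real \<alpha> - y))) * wedge_deriv \<kappa> r"
        unfolding eq[OF s, symmetric] by (simp add: distrib_right)
      also have "norm \<dots> \<le> exp (1 - \<kappa> * \<bar>r\<bar>) * (norm ?s powr \<alpha> / ((\<delta> * t) * (\<delta> * t))) * (1 + \<kappa>)"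
      proof -
        have "norm (?s powr of_real \<alpha>) = norm ?s powr \<alpha>" by (subst norm_powr_real_powr') auto
        moreover have "(\<delta> * t) * (\<delta> * t) \<le> norm y * norm (?s powr of_real \<alpha> - y)"
          using d by (intro mult_mono y \<delta>[OF s]) auto
        ultimately have le: "norm (?s powr of_real \<alpha> / (y * (?s powr of_real \<alpha> - y))) \<le> norm ?s powr \<alpha> / ((\<delta> * t) * (\<delta> * t))"
          unfolding norm_divide norm_mult[of y]
          by (intro frac_le) (use mult_pos_pos[OF d d] in simp_all)
        have "norm (exp ?s * (?s powr of_real \<alpha> / (y * (?s powr of_real \<alpha> - y))))
            \<le> exp (1 - \<kappa> * \<bar>r\<bar>) * (norm ?s powr \<alpha> / ((\<delta> * t) * (\<delta> * t)))"
          unfolding norm_mult[of "exp ?s"] by (rule mult_mono[OF _ le]) simp_all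
        then show ?thesis
          unfolding norm_mult[of "_ * _" "wedge_deriv \<kappa> r"]
          by (rule mult_mono[OF _ norm_wedge_deriv_le]) (use *(1) in simp_all)
      qed
      also have "\<dots> = exp 1 * (1 + \<kappa>) / (\<delta> * t)\<^sup>2 * (exp (- \<kappa> * \<bar>r\<bar>) * norm ?s powr \<alpha>)"
        by (simp add: exp_diff exp_minus power2_eq_square divide_inverse mult_ac)
      finally show "norm (?f ?s * wedge_deriv \<kappa> r + exp ?s * wedge_deriv \<kappa> r / y)
          \<le> exp 1 * (1 + \<kappa>) / (\<delta> * t)\<^sup>2 * (exp (- \<kappa> * \<bar>r\<bar>) * norm ?s powr \<alpha>)" .
    qed
    then have "norm (wedge_integral \<kappa> ?f 1) \<le> exp 1 * (1 + \<kappa>) / (\<delta> * t)\<^sup>2 * J"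
      by (simp add: J_def)
    then have "norm (wedge_integral \<kappa> ?f 1 / (2 * of_real pi * \<i>)) \<le> exp 1 * (1 + \<kappa>) / (\<delta> * t)\<^sup>2 * J / (2 * pi)"
      unfolding norm_divide n2 by (rule divide_right_mono) simp
    also have "\<dots> = C / t\<^sup>2" by (simp add: C_def power_mult_distrib)
    finally show ?thesis
      using sums_unique[OF ml_integral[OF *(1) zero_less_one assms(1) order.refl d \<delta>]] by (simp add: y_def)
  qed
  ultimately show ?thesis by (rule that)
qed

section \<open>Mittag-Leffler functions of matrices\<close>

text \<open>Partial sums are polynomials, to which the spectral bound applies. On \<open>K\<close>
  they differ from the full scalar series by at most a uniform tail, which vanishes in the
  limit.\<close>

lemma mat_series_bound:
  fixes B :: "complex^'n^'n" and d :: "nat \<Rightarrow> complex"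
  assumes "C \<ge> 0" "R \<ge> 0" "M \<ge> 0" and R: "\<And>z. z \<in> K \<Longrightarrow> norm z \<le> R"
    and C: "\<And>p M. M \<ge> 0 \<Longrightarrow> (\<And>z. z \<in> K \<Longrightarrow> norm (poly p z) \<le> M) \<Longrightarrow> norm (mat_poly B p) \<le> C * M"
    and d: "summable (\<lambda>k. norm (d k) * R ^ k)"
    and M: "\<And>z. z \<in> K \<Longrightarrow> norm (\<Sum>k. d k * z ^ k) \<le> M"
  shows "norm (\<Sum>k. mat (d k) ** mat_power B k) \<le> C * M"
proof -
  let ?e = "\<lambda>k. norm (d k) * R ^ k"
  have le: "norm (mat (d k) ** mat_power B k) \<le> C * ?e k" for k
  proof -
    have "norm (mat_poly B (monom (d k) k)) \<le> C * ?e k"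
      using R assms(2) by (intro C) (auto simp: poly_monom norm_mult norm_power intro!: mult_left_mono power_mono)
    then show ?thesis by (simp add: mat_poly_monom)
  qed
  have sum: "summable (\<lambda>k. mat (d k) ** mat_power B k)"
    by (rule summable_comparison_test'[OF summable_mult[OF d] le])
  \<comment> \<open>The tail of the majorant series at radius \<open>R\<close>, the same for all
    points of \<open>K\<close>.\<close>
  define \<epsilon> where "\<epsilon> = (\<lambda>n. suminf ?e - (\<Sum>k<n. ?e k))"
  have \<epsilon>: "\<epsilon> n \<ge> 0" for n
    using sum_le_suminf[OF d, of "{..<n}"] assms(2) by (simp add: \<epsilon>_def)
  have "(\<lambda>n. \<epsilon> n) \<longlonglongrightarrow> suminf ?e - suminf ?e"
    unfolding \<epsilon>_def by (intro tendsto_diff tendsto_const summable_LIMSEQ d)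
  then have "\<epsilon> \<longlonglongrightarrow> 0" by simp
  then have lim: "(\<lambda>n. C * (M + \<epsilon> n)) \<longlonglongrightarrow> C * (M + 0)"
    by (intro tendsto_intros)
  have "norm (\<Sum>k<n. mat (d k) ** mat_power B k) \<le> C * (M + \<epsilon> n)" for n
  proof -
    have "norm (mat_poly B (\<Sum>k<n. monom (d k) k)) \<le> C * (M + \<epsilon> n)"
    proof (rule C)
      show "M + \<epsilon> n \<ge> 0" using assms(3) \<epsilon>[of n] by simp
      fix z assume z: "z \<in> K"
      have le: "norm (d k * z ^ k) \<le> ?e k" for k
        using R[OF z] by (auto simp: norm_mult norm_power intro!: mult_left_mono power_mono)
      have s: "summable (\<lambda>k. d k * z ^ k)"
        by (rule summable_comparison_test'[OF d]) (rule le)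
      have "norm (\<Sum>k. d (k + n) * z ^ (k + n)) \<le> (\<Sum>k. ?e (k + n))"
        by (rule norm_suminf_le[OF le summable_ignore_initial_segment[OF d]])
      also have "\<dots> = \<epsilon> n" unfolding \<epsilon>_def by (rule suminf_minus_initial_segment[OF d])
      finally have "norm ((\<Sum>k. d k * z ^ k) - (\<Sum>k<n. d k * z ^ k)) \<le> \<epsilon> n"
        by (simp add: suminf_minus_initial_segment[OF s])
      then have "norm (\<Sum>k<n. d k * z ^ k) \<le> M + \<epsilon> n"
        using M[OF z] norm_triangle_sub[of "\<Sum>k<n. d k * z ^ k" "\<Sum>k. d k * z ^ k"]
        by (simp add: norm_minus_commute)
      then show "norm (poly (\<Sum>k<n. monom (d k) k) z) \<le> M + \<epsilon> n"
        by (simp add: poly_sum poly_monom)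
    qed
    then show ?thesis by (simp add: mat_poly_sum mat_poly_monom)
  qed
  then have "norm (\<Sum>k. mat (d k) ** mat_power B k) \<le> C * (M + 0)"
    using LIMSEQ_le[OF tendsto_norm[OF summable_LIMSEQ[OF sum]] lim] by blast
  then show ?thesis by simp
qed

lemma mat_power_mat_mult: "mat_power (mat c ** B) k = mat (c ^ k) ** mat_power (B :: 'a::comm_semiring_1^'n^'n) k"
proof (induction k)
  case (Suc k)
  have "mat_power (mat c ** B) (Suc k) = mat c ** (B ** (mat (c ^ k) ** mat_power B k))"
    by (simp add: Suc matrix_mul_assoc)
  also have "\<dots> = mat (c ^ Suc k) ** mat_power B (Suc k)"
    by (simp add: mat_mult_left_commute[of B]) (simp add: matrix_mul_assoc mat_mult_mat)
  finally show ?case .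
qed simp

text \<open>Moving \<open>t\<close> into the coefficients leaves a series in the fixed matrix
  \<open>A\<close>, so \<open>K\<close> and the constant of the spectral bound do not vary with
  \<open>t\<close>.\<close>

lemma mittag_leffler_scaled:
  fixes A :: "real^'n^'n"
  shows "mittag_leffler \<alpha> \<beta> (cmat (t *\<^sub>R A)) =
    (\<Sum>k. mat (rGamma (of_real (\<alpha> * real k) + \<beta>) * of_real t ^ k) ** mat_power (cmat A) k)"
proof -
  have "cmat (t *\<^sub>R A) = mat (of_real t) ** cmat A"
    by (simp add: vec_eq_iff mat_mult_nth map_matrix_def)
  then show ?thesis
    by (simp add: mittag_leffler_def map_matrix_mult_eq_mat mat_power_mat_mult matrix_mul_assoc mat_mult_mat)
qed

text \<open>Expansion in the real Euclidean basis, where real homogeneity and the triangle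
  inequality give the bound.\<close>

lemma matrix_norm_bounded:
  fixes N :: "complex^'n^'m \<Rightarrow> real"
  assumes N: "is_matrix_norm N"
  obtains D where "D \<ge> 0" "\<And>X. N X \<le> D * norm X"
proof -
  define D where "D = (\<Sum>b\<in>Basis. N b)"
  have N0: "N 0 = 0" using N by (simp add: is_matrix_norm_def)
  have tri: "N (X + Y) \<le> N X + N Y" for X Y using N by (simp add: is_matrix_norm_def)
  have sum_le: "N (sum f I) \<le> (\<Sum>i\<in>I. N (f i))" for f and I :: "(complex^'n^'m) set"
    by (induction I rule: infinite_finite_induct) (auto simp: N0 intro: order_trans[OF tri])
  have "N X \<le> D * norm X" for X
  proof -
    have "N X = N (\<Sum>b\<in>Basis. (X \<bullet> b) *\<^sub>R b)" by (simp add: euclidean_representation)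
    also have "\<dots> \<le> (\<Sum>b\<in>Basis. N ((X \<bullet> b) *\<^sub>R b))" by (rule sum_le)
    also have "\<dots> \<le> (\<Sum>b\<in>Basis. norm X * N b)"
      using N by (intro sum_mono) (auto simp: is_matrix_norm_def Basis_le_norm intro!: mult_right_mono)
    finally show ?thesis by (simp add: D_def sum_distrib_left mult.commute)
  qed
  moreover have "D \<ge> 0" using N by (auto simp: D_def is_matrix_norm_def intro!: sum_nonneg)
  ultimately show ?thesis by (rule that[rotated])
qed

text \<open>Provides the measurability of the integrand in the second claim.\<close>

lemma matrix_norm_continuous:
  fixes N :: "complex^'n^'m \<Rightarrow> real"
  assumes N: "is_matrix_norm N"
  shows "continuous_on UNIV N"
proof -
  obtain D where D: "D \<ge> 0" "\<And>X. N X \<le> D * norm X" by (rule matrix_norm_bounded[OF N]) blast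
  have tri: "N X \<le> N Y + N (X - Y)" for X Y
    using N[unfolded is_matrix_norm_def] by (metis add_diff_cancel_left' add.commute diff_add_cancel)
  have "\<bar>N X - N Y\<bar> \<le> D * norm (X - Y)" for X Y
    using tri[of X Y] tri[of Y X] D(2)[of "X - Y"] D(2)[of "Y - X"]
    by (simp add: norm_minus_commute)
  then have "D-lipschitz_on UNIV N"
    using D(1) by (intro lipschitz_onI) (auto simp: dist_norm)
  then show ?thesis by (rule lipschitz_on_continuous_on)
qed

text \<open>Cosine decreases on \<open>{0..pi}\<close>. The resulting inequality defines a visibly
  open set, unlike the condition on the discontinuous \<open>Arg\<close>.\<close>

lemma sector_Arg:
  assumes "0 < \<alpha>" "\<mu> \<noteq> 0" "\<bar>Arg \<mu>\<bar> > \<alpha> * pi / 2"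
  shows "Re \<mu> < norm \<mu> * cos (\<alpha> * pi / 2)"
proof -
  have "\<bar>Arg \<mu>\<bar> \<le> pi" using Arg_bounded[of \<mu>] by linarith
  then have "cos \<bar>Arg \<mu>\<bar> < cos (\<alpha> * pi / 2)"
    using assms by (intro cos_monotone_0_pi) auto
  moreover have "cos \<bar>Arg \<mu>\<bar> = cos (Arg \<mu>)" by (cases "Arg \<mu> \<ge> 0") auto
  moreover have "Re \<mu> = norm \<mu> * cos (Arg \<mu>)"
    using Re_rcis[of "norm \<mu>" "Arg \<mu>"] by (simp add: rcis_cmod_Arg)
  moreover have "norm \<mu> > 0" using assms(2) by simp
  ultimately show ?thesis using mult_strict_left_mono by metis
qed

section \<open>Integrable powers near 0 and near infinity\<close>

lemma set_integrable_powr_near_0: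
  assumes "e > -1"
  shows "set_integrable lborel {0<..1} (\<lambda>x::real. x powr e)"
proof -
  have "(\<lambda>x. x powr e) integrable_on {0..1}"
    by (rule integrable_on_powr_from_0) (use assms in auto)
  then have "(\<lambda>x. x powr e) absolutely_integrable_on {0..1}"
    by (subst absolutely_integrable_on_iff_nonneg) auto
  then have "set_integrable lborel {0..1} (\<lambda>x::real. x powr e)"
    unfolding set_integrable_def by (subst (asm) integrable_completion) auto
  then show ?thesis by (rule set_integrable_subset) auto
qed

lemma set_integrable_powr_at_infinity:
  assumes "e < -1"
  shows "set_integrable lborel {1..} (\<lambda>x::real. x powr e)"
proof -
  have "(\<lambda>x. x powr e) integrable_on {1..}"
    using has_integral_powr_to_inf[OF assms, of 1] by (auto simp: integrable_on_def)
  then have "(\<lambda>x. x powr e) absolutely_integrable_on {1..}"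
    by (subst absolutely_integrable_on_iff_nonneg) auto
  then show ?thesis
    unfolding set_integrable_def by (subst (asm) integrable_completion) auto
qed

theorem lemma5:
  fixes \<alpha> :: real and A :: "real^'d^'d" and N :: "complex^'d^'d \<Rightarrow> real"
  assumes "0 < \<alpha>" and "\<alpha> < 1"
    and "is_matrix_norm N"
    and "mat_spectrum (cmat A) \<subseteq> {\<mu>. \<mu> \<noteq> 0 \<and> \<bar>Arg \<mu>\<bar> > \<alpha> * pi / 2}"
  shows "((\<lambda>t. N (mittag_leffler \<alpha> 1 (cmat ((t powr \<alpha>) *\<^sub>R A)))) \<longlongrightarrow> 0) at_top \<and>
         set_integrable lborel {0<..}
           (\<lambda>\<tau>. \<tau> powr (\<alpha> - 1) * N (mittag_leffler \<alpha> (of_real \<alpha>) (cmat ((\<tau> powr \<alpha>) *\<^sub>R A))))"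
proof -
  let ?W = "{z. Re z < norm z * cos (\<alpha> * pi / 2)}"
  have "open ?W" by (intro open_Collect_less continuous_intros)
  moreover have "mat_spectrum (cmat A) \<subseteq> ?W" using assms(4) sector_Arg[OF assms(1)] by blast
  ultimately obtain K C where K: "compact K" "K \<subseteq> ?W" and C: "C \<ge> 0"
    "\<And>p M. M \<ge> 0 \<Longrightarrow> (\<And>z. z \<in> K \<Longrightarrow> norm (poly p z) \<le> M) \<Longrightarrow> norm (mat_poly (cmat A) p) \<le> C * M"
    by (rule spectral_bound) blast
  obtain R where R: "R > 0" "\<And>z. z \<in> K \<Longrightarrow> norm z \<le> R"
    using compact_imp_bounded[OF K(1)] by (auto simp: bounded_pos)
  obtain D where D: "D \<ge> 0" "\<And>X. N X \<le> D * norm X"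
    by (rule matrix_norm_bounded[OF assms(3)]) blast
  have N_nonneg: "N X \<ge> 0" for X using assms(3) by (simp add: is_matrix_norm_def)
  define c where "c = (\<lambda>\<beta> k. rGamma (complex_of_real (\<alpha> * real k + \<beta>)))"
  define E where "E = (\<lambda>\<beta> t. \<Sum>k. mat (c \<beta> k * of_real t ^ k) ** mat_power (cmat A) k)"
  have E: "mittag_leffler \<alpha> (of_real \<beta>) (cmat (t *\<^sub>R A)) = E \<beta> t" for \<beta> t
    by (simp add: mittag_leffler_scaled E_def c_def)
  \<comment> \<open>Scalar bounds on \<open>K\<close> pass to \<open>N\<close>: the factor
    \<open>C\<close> comes from the spectral bound, \<open>D\<close> from comparing norms.\<close>
  have E_bound: "N (E \<beta> t) \<le> D * (C * M)"
    if "\<alpha> \<le> \<beta>" "t \<ge> 0" "M \<ge> 0" and M: "\<And>z. z \<in> K \<Longrightarrow> norm (\<Sum>k. c \<beta> k * (of_real t * z) ^ k) \<le> M" for \<beta> t M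
  proof -
    have "norm (E \<beta> t) \<le> C * M"
      unfolding E_def
    proof (rule mat_series_bound[OF C(1) _ that(3) R(2) C(2)])
      have "summable (\<lambda>k. norm (c \<beta> k) * (t * R) ^ k)"
        unfolding c_def using R(1) that by (intro ml_norm_summable assms) auto
      then show "summable (\<lambda>k. norm (c \<beta> k * of_real t ^ k) * R ^ k)"
        using that by (simp add: norm_mult norm_power power_mult_distrib mult.assoc)
      show "norm (\<Sum>k. c \<beta> k * of_real t ^ k * z ^ k) \<le> M" if "z \<in> K" for z
        using M[OF that] by (simp add: power_mult_distrib mult.assoc)
    qed (use R(1) in auto)
    then show ?thesis using D order_trans mult_left_mono by metis
  qed
  obtain C1 where C1: "C1 \<ge> 0" "\<And>z t. z \<in> K \<Longrightarrow> t > 0 \<Longrightarrow> norm (\<Sum>k. c 1 k * (of_real t * z) ^ k) \<le> C1 / t"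
    unfolding c_def by (rule ml_1_decay[OF assms(1,2) K]) blast
  obtain C2 where C2: "C2 \<ge> 0" "\<And>z t. z \<in> K \<Longrightarrow> t > 0 \<Longrightarrow> norm (\<Sum>k. c \<alpha> k * (of_real t * z) ^ k) \<le> C2 / t\<^sup>2"
    unfolding c_def by (rule ml_alpha_decay[OF assms(1,2) K]) blast
  have "((\<lambda>t. N (E 1 (t powr \<alpha>))) \<longlongrightarrow> 0) at_top"
  proof (rule Lim_null_comparison)
    show "\<forall>\<^sub>F t in at_top. norm (N (E 1 (t powr \<alpha>))) \<le> D * C * C1 * t powr (- \<alpha>)"
      using eventually_gt_at_top[of 0]
    proof eventually_elim
      case (elim t)
      then have "N (E 1 (t powr \<alpha>)) \<le> D * (C * (C1 / t powr \<alpha>))"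
        using C1 assms(2) by (intro E_bound) auto
      then show ?case using N_nonneg by (simp add: powr_minus divide_inverse mult.assoc)
    qed
    show "((\<lambda>t. D * C * C1 * t powr (- \<alpha>)) \<longlongrightarrow> 0) at_top"
      using assms(1) by (intro tendsto_mult_right_zero tendsto_neg_powr filterlim_ident) auto
  qed
  \<comment> \<open>Near 0 the matrix function is bounded and
    \<open>\<tau> powr (\<alpha> - 1)\<close> is integrable. Beyond 1 the quadratic decay in
    \<open>\<tau> powr \<alpha>\<close> makes the integrand of order
    \<open>\<tau> powr (- 1 - \<alpha>)\<close>.\<close>
  moreover have "set_integrable lborel {0<..} (\<lambda>\<tau>. \<tau> powr (\<alpha> - 1) * N (E \<alpha> (\<tau> powr \<alpha>)))"
  proof -
    let ?g = "\<lambda>\<tau>. \<tau> powr (\<alpha> - 1) * N (E \<alpha> (\<tau> powr \<alpha>))"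
    have g_norm: "norm (?g \<tau>) = ?g \<tau>" for \<tau> using N_nonneg by simp
    have [measurable]: "N \<in> borel_measurable borel"
      by (intro borel_measurable_continuous_onI matrix_norm_continuous assms)
    \<comment> \<open>With the real power as a scalar in front of a constant matrix, measurability
      in \<open>\<tau>\<close> becomes that of a series of measurable functions.\<close>
    have "mat (c \<alpha> k * of_real t ^ k) ** mat_power (cmat A) k = t ^ k *\<^sub>R (mat (c \<alpha> k) ** mat_power (cmat A) k)" for k t
    proof -
      have "mat (c \<alpha> k * of_real t ^ k) = mat (of_real (t ^ k)) ** (mat (c \<alpha> k) :: complex^'d^'d)"
        by (simp add: mat_mult_mat mult.commute)
      then show ?thesis by (metis mat_scaleR matrix_mul_assoc)
    qed
    then have "(\<lambda>\<tau>. E \<alpha> (\<tau> powr \<alpha>)) = (\<lambda>\<tau>. \<Sum>k. (\<tau> powr \<alpha>) ^ k *\<^sub>R (mat (c \<alpha> k) ** mat_power (cmat A) k))"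
      by (simp add: E_def)
    then have [measurable]: "(\<lambda>\<tau>. E \<alpha> (\<tau> powr \<alpha>)) \<in> borel_measurable borel" by simp
    have meas: "set_borel_measurable lborel S ?g" if "S \<in> sets borel" for S
      unfolding set_borel_measurable_def using that by measurable
    define S where "S = (\<Sum>k. norm (c \<alpha> k) * R ^ k)"
    have sum: "summable (\<lambda>k. norm (c \<alpha> k) * R ^ k)"
      unfolding c_def using R(1) by (intro ml_norm_summable assms) auto
    have near: "set_integrable lborel {0<..1} ?g"
    proof (rule set_integrable_bound)
      show "set_integrable lborel {0<..1} (\<lambda>\<tau>. D * (C * S) * \<tau> powr (\<alpha> - 1))"
        using set_integrable_powr_near_0[of "\<alpha> - 1"] assms(1) by simp
      have "norm (?g \<tau>) \<le> norm (D * (C * S) * \<tau> powr (\<alpha> - 1))" if \<tau>: "0 < \<tau>" "\<tau> \<le> 1" for \<tau>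
      proof -
        have "S \<ge> 0" unfolding S_def by (rule suminf_nonneg[OF sum]) (use R(1) in auto)
        have "N (E \<alpha> (\<tau> powr \<alpha>)) \<le> D * (C * S)"
        proof (rule E_bound)
          fix z assume z: "z \<in> K"
          have "\<tau> powr \<alpha> \<le> 1" using \<tau> assms(1) by (simp add: powr_le1)
          \<comment> \<open>For \<open>\<tau>\<close> up to 1 the scaled points stay within radius
            \<open>R\<close>, so the absolute series \<open>S\<close> bounds the function
            uniformly.\<close>
          then have "\<tau> powr \<alpha> * norm z \<le> 1 * R" using R(2)[OF z] by (intro mult_mono) auto
          then show "norm (\<Sum>k. c \<alpha> k * (of_real (\<tau> powr \<alpha>) * z) ^ k) \<le> S"
            unfolding S_def
            by (intro norm_suminf_le[OF _ sum]) (auto simp: norm_mult norm_power intro!: mult_left_mono power_mono)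
        qed (use \<open>S \<ge> 0\<close> in auto)
        then have "?g \<tau> \<le> \<tau> powr (\<alpha> - 1) * (D * (C * S))" by (intro mult_left_mono) auto
        also have "\<dots> = D * (C * S) * \<tau> powr (\<alpha> - 1)" by (rule mult.commute)
        also have "\<dots> \<le> norm \<dots>" unfolding real_norm_def by (rule abs_ge_self)
        finally show ?thesis unfolding g_norm .
      qed
      then show "AE \<tau> in lborel. \<tau> \<in> {0<..1} \<longrightarrow> norm (?g \<tau>) \<le> norm (D * (C * S) * \<tau> powr (\<alpha> - 1))"
        by (intro AE_I2) auto
    qed (rule meas, simp)
    have far: "set_integrable lborel {1..} ?g"
    proof (rule set_integrable_bound)
      show "set_integrable lborel {1..} (\<lambda>\<tau>. D * (C * C2) * \<tau> powr (- 1 - \<alpha>))"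
        using set_integrable_powr_at_infinity[of "- 1 - \<alpha>"] assms(1) by simp
      have "norm (?g \<tau>) \<le> norm (D * (C * C2) * \<tau> powr (- 1 - \<alpha>))" if \<tau>: "1 \<le> \<tau>" for \<tau>
      proof -
        have "N (E \<alpha> (\<tau> powr \<alpha>)) \<le> D * (C * (C2 / (\<tau> powr \<alpha>)\<^sup>2))"
          using C2 \<tau> by (intro E_bound) auto
        then have "?g \<tau> \<le> \<tau> powr (\<alpha> - 1) * (D * (C * (C2 / (\<tau> powr \<alpha>)\<^sup>2)))" by (intro mult_left_mono) auto
        also have "\<dots> = D * (C * C2) * (\<tau> powr (\<alpha> - 1) / (\<tau> powr \<alpha>)\<^sup>2)" by simp
        also have "\<tau> powr (\<alpha> - 1) / (\<tau> powr \<alpha>)\<^sup>2 = \<tau> powr (- 1 - \<alpha>)"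
          unfolding power2_eq_square powr_add[symmetric] powr_diff[symmetric]
          by (rule arg_cong[of _ _ "\<lambda>e. \<tau> powr e"]) simp
        also have "D * (C * C2) * \<tau> powr (- 1 - \<alpha>) \<le> norm (D * (C * C2) * \<tau> powr (- 1 - \<alpha>))"
          unfolding real_norm_def by (rule abs_ge_self)
        finally show ?thesis unfolding g_norm .
      qed
      then show "AE \<tau> in lborel. \<tau> \<in> {1..} \<longrightarrow> norm (?g \<tau>) \<le> norm (D * (C * C2) * \<tau> powr (- 1 - \<alpha>))"
        by (intro AE_I2) auto
    qed (rule meas, simp)
    have "set_integrable lborel ({0<..1} \<union> {1..}) ?g"
      by (rule set_integrable_Un[OF near far]) simp_all
    moreover have "{0<..1} \<union> {1..} = {0::real<..}" by auto
    ultimately show ?thesis by simp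
  qed
  ultimately show ?thesis using E[of 1] E[of \<alpha>] by simp
qed

end
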